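(* Let $M,s\in\mathbb N$ with $M\ge 2$, let $\alpha>1/2$ be real, $\boldsymbol\gamma=(\gamma_1,\gamma_2,\ldots)\in[0,1]^{\mathbb N}$ and $\tau\in(0,1)$. Assume $$M\ \ge\ \inf_{1/2\le\lambda'<\alpha}\ \frac{2}{1-\tau}\sum_{\emptyset\ne u\subseteq\{1,\ldots,s\}}\gamma_u^{1/\lambda'}\bigl(2\zeta(\alpha/\lambda')\bigr)^{|u|}.$$ Then for any $1/2<\lambda<\alpha$ and $0<\delta<\min(\lambda-1/2,1)$, the randomized error of the randomized rank-1 lattice rule $A_{M,\tau}$ satisfies $$e^{\mathrm{rand}}(H_{s,\alpha,\boldsymbol\gamma},A_{M,\tau})\ \le\ \frac{C_{\lambda,\delta,\tau}}{M^{\lambda+1/2-\delta}}\left(\sum_{\emptyset\ne u\subseteq\{1,\ldots,s\}}\gamma_u^{1/\lambda}\bigl(2\zeta(\alpha/\lambda)\bigr)^{|u|}\right)^{\lambda-\delta},$$ where $C_{\lambda,\delta,\tau}>0$ is a constant depending only on $\lambda,\delta,\tau$.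
   Context: Notation: $\mathbb N=\{1,2,\ldots\}$; $\zeta$ is the Riemann zeta function; $\gamma_u=\prod_{j\in u}\gamma_j$. $I(f)=\int_{[0,1)^s}f(\boldsymbol x)\,d\boldsymbol x$, and for a finite point (multi)set $P$ with $N$ elements, $I(f;P)=\frac1N\sum_{\boldsymbol x\in P}f(\boldsymbol x)$. Weighted Korobov space. For $\boldsymbol k\in\mathbb Z^{\ell}$ put $r_{\alpha,\boldsymbol\gamma}(\boldsymbol k)=\prod_{j:\,k_j\ne0}|k_j|^\alpha/\gamma_j$ (empty product $=1$; if $k_j\neq 0$ and $\gamma_j=0$ for some $j$, then $1/r_{\alpha,\boldsymbol\gamma}(\boldsymbol k)=0$). $H_{s,\alpha,\boldsymbol\gamma}$ is the space of functions $f:[0,1)^s\to\mathbb R$ (one-periodic in each variable) with absolutely convergent Fourier series $f(\boldsymbol x)=\sum_{\boldsymbol k\in\mathbb Z^s}\hat f(\boldsymbol k)e^{2\pi i\boldsymbol k\cdot\boldsymbol x}$ and finite norm $\|f\|_{s,\alpha,\boldsymbol\gamma}=\bigl(\sum_{\boldsymbol k\in\mathbb Z^s}r_{\alpha,\boldsymbol\gamma}(\boldsymbol k)^2|\hat f(\boldsymbol k)|^2\bigr)^{1/2}$; if $\gamma_j=0$, it is required that $\hat f(\boldsymbol k)=0$ whenever $k_j\ne0$ (and such terms contribute $0$ to the norm). Lattice rules. For $N\ge2$ and $\boldsymbol z\in\{1,\ldots,N-1\}^{\ell}$, the rank-1 lattice point set is $P_{N,\boldsymbol z}=\{\{n\boldsymbol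 z/N\}:n=0,\ldots,N-1\}$ (componentwise fractional parts), and its dual lattice is $P_{N,\boldsymbol z}^\perp=\{\boldsymbol k\in\mathbb Z^{\ell}:\boldsymbol k\cdot\boldsymbol z\equiv0\pmod N\}$. Let $R_{\alpha,\boldsymbol\gamma}(\boldsymbol z)=\sum_{\boldsymbol k\in P_{N,\boldsymbol z}^\perp\setminus\{\boldsymbol 0\}}r_{\alpha,\boldsymbol\gamma}(\boldsymbol k)^{-2}$. Randomized component-by-component algorithm. Let $\mathbb P_M=\{N \text{ prime}:\lceil M/2\rceil<N\le M\}$. (1) Pick $N\in\mathbb P_M$ uniformly at random. (2) Set $z_1=1$. (3) For $\ell=2,\ldots,s$, given $\boldsymbol z_{\ell-1}=(z_1,\ldots,z_{\ell-1})$, let $Z_\ell\subset\{1,\ldots,N-1\}$ consist of the $\lceil\tau(N-1)\rceil$ elements $\zeta$ with the smallest values of $R_{\alpha,\boldsymbol\gamma}(\boldsymbol z_{\ell-1},\zeta)$ (ties broken in favour of the smaller integer), and pick $z_\ell\in Z_\ell$ uniformly at random. For $N\in\mathbb P_M$, $\mathcal Z_{N,\tau}\subseteq\{1,\ldots,N-1\}^s$ denotes the set of all vectors $\boldsymbol z=(z_1,\ldots,z_s)$ that steps (2)–(3) can produce. The randomized algorithm is $A_{M,\tau}(f)=I(f;P_{N,\boldsymbol z})$ with $N$ uniform in $\mathbb P_M$ and $\boldsymbol z$ uniform in $\mathcal Z_{N,\tau}$, and its randomized error is $$e^{\mathrm{rand}}(H_{s,\alpha,\boldsymbol\gamma},A_{M,\tau})=\sup_{\|f\|_{s,\alpha,\boldsymbol\gamma}\le1}\frac1{|\mathbb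 P_M|}\sum_{N\in\mathbb P_M}\frac1{|\mathcal Z_{N,\tau}|}\sum_{\boldsymbol z\in\mathcal Z_{N,\tau}}|I(f;P_{N,\boldsymbol z})-I(f)|.$$ *)

theory Defs
  imports "HOL-Analysis.Analysis" "HOL-Number_Theory.Cong"
begin

text \<open>
  Vectors of length \<open>s\<close> are functions on \<open>nat\<close> indexed by \<open>1, ..., s\<close>; point sets and frequency
  sets consist of extensional functions (\<open>PiE\<close>), so that each vector is represented once.
  Weights are sequences \<open>\<gamma> 1, \<gamma> 2, ...\<close>; the value \<open>\<gamma> 0\<close> is never used.
\<close>

text \<open>The Dirichlet series of the zeta function; only used for \<open>x > 1\<close>.\<close>

definition riemann_zeta :: "real \<Rightarrow> real" where
  "riemann_zeta x = (\<Sum>n. 1 / real (Suc n) powr x)"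

definition unit_cube :: "nat \<Rightarrow> (nat \<Rightarrow> real) set" where
  "unit_cube s = PiE {1..s} (\<lambda>_. {0..<1})"

definition int_vecs :: "nat \<Rightarrow> (nat \<Rightarrow> int) set" where
  "int_vecs s = PiE {1..s} (\<lambda>_. UNIV)"

abbreviation lborel_pow :: "nat \<Rightarrow> (nat \<Rightarrow> real) measure" where
  "lborel_pow s \<equiv> PiM {1..s} (\<lambda>_. lborel)"

definition cube_integral :: "nat \<Rightarrow> ((nat \<Rightarrow> real) \<Rightarrow> real) \<Rightarrow> real" where
  "cube_integral s f = (LINT x:unit_cube s|lborel_pow s. f x)"

definition qmc_rule :: "((nat \<Rightarrow> real) \<Rightarrow> real) \<Rightarrow> (nat \<Rightarrow> real) multiset \<Rightarrow> real" where
  "qmc_rule f P = (\<Sum>x\<in>#P. f x) / real (size P)"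


section \<open>Weighted Korobov spaces\<close>

text \<open>
  If \<open>k j \<noteq> 0\<close> and \<open>\<gamma> j = 0\<close> for some \<open>j\<close>, then \<open>r\<close> is formally infinite. Because
  \<open>x / 0 = 0\<close>, the value below is then \<open>0\<close>, which implements both conventions in use:
  \<open>1 / r = 0\<close>, and such frequencies contribute \<open>0\<close> to the norm. That the corresponding Fourier
  coefficients vanish is a separate clause of \<open>korobov_space\<close>.
\<close>

definition korobov_r :: "nat \<Rightarrow> real \<Rightarrow> (nat \<Rightarrow> real) \<Rightarrow> (nat \<Rightarrow> int) \<Rightarrow> real" where
  "korobov_r l \<alpha> \<gamma> k = (\<Prod>j\<in>{j\<in>{1..l}. k j \<noteq> 0}. \<bar>real_of_int (k j)\<bar> powr \<alpha> / \<gamma> j)"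

definition phase :: "nat \<Rightarrow> (nat \<Rightarrow> int) \<Rightarrow> (nat \<Rightarrow> real) \<Rightarrow> real" where
  "phase s k x = 2 * pi * (\<Sum>j=1..s. real_of_int (k j) * x j)"

definition fourier_coeff :: "nat \<Rightarrow> ((nat \<Rightarrow> real) \<Rightarrow> real) \<Rightarrow> (nat \<Rightarrow> int) \<Rightarrow> complex" where
  "fourier_coeff s f k =
     (LINT x:unit_cube s|lborel_pow s. complex_of_real (f x) * cis (- phase s k x))"

text \<open>
  A function on \<open>[0,1)\<^sup>s\<close> is identified with its one-periodic extension, so only the values on
  \<open>unit_cube s\<close> matter.
\<close>

definition korobov_space ::
    "nat \<Rightarrow> real \<Rightarrow> (nat \<Rightarrow> real) \<Rightarrow> ((nat \<Rightarrow> real) \<Rightarrow> real) set" where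
  "korobov_space s \<alpha> \<gamma> = {f.
     (\<lambda>k. norm (fourier_coeff s f k)) summable_on int_vecs s \<and>
     (\<forall>x\<in>unit_cube s.
        ((\<lambda>k. fourier_coeff s f k * cis (phase s k x)) has_sum complex_of_real (f x))
          (int_vecs s)) \<and>
     (\<lambda>k. (korobov_r s \<alpha> \<gamma> k)\<^sup>2 * (norm (fourier_coeff s f k))\<^sup>2) summable_on int_vecs s \<and>
     (\<forall>k\<in>int_vecs s. (\<exists>j\<in>{1..s}. \<gamma> j = 0 \<and> k j \<noteq> 0) \<longrightarrow> fourier_coeff s f k = 0)}"

definition korobov_norm ::
    "nat \<Rightarrow> real \<Rightarrow> (nat \<Rightarrow> real) \<Rightarrow> ((nat \<Rightarrow> real) \<Rightarrow> real) \<Rightarrow> real" where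
  "korobov_norm s \<alpha> \<gamma> f =
     sqrt (\<Sum>\<^sub>\<infinity>k\<in>int_vecs s. (korobov_r s \<alpha> \<gamma> k)\<^sup>2 * (norm (fourier_coeff s f k))\<^sup>2)"


section \<open>Rank-1 lattice rules\<close>

definition lattice_points :: "nat \<Rightarrow> nat \<Rightarrow> (nat \<Rightarrow> nat) \<Rightarrow> (nat \<Rightarrow> real) multiset" where
  "lattice_points s N z =
     {# \<lambda>j\<in>{1..s}. frac (real n * real (z j) / real N). n \<in># mset_set {0..<N} #}"

definition dual_lattice :: "nat \<Rightarrow> nat \<Rightarrow> (nat \<Rightarrow> nat) \<Rightarrow> (nat \<Rightarrow> int) set" where
  "dual_lattice l N z = {k \<in> int_vecs l. [(\<Sum>j=1..l. k j * int (z j)) = 0] (mod int N)}"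

definition lattice_R ::
    "nat \<Rightarrow> real \<Rightarrow> (nat \<Rightarrow> real) \<Rightarrow> nat \<Rightarrow> (nat \<Rightarrow> nat) \<Rightarrow> real" where
  "lattice_R l \<alpha> \<gamma> N z =
     (\<Sum>\<^sub>\<infinity>k\<in>dual_lattice l N z - {\<lambda>j\<in>{1..l}. 0}. 1 / (korobov_r l \<alpha> \<gamma> k)\<^sup>2)"


section \<open>The randomized component-by-component algorithm\<close>

definition primes_M :: "nat \<Rightarrow> nat set" where
  "primes_M M = {N. prime N \<and> \<lceil>real M / 2\<rceil> < int N \<and> N \<le> M}"

text \<open>
  The set \<open>Z\<^sub>l\<close>. Since \<open>sort_key\<close> is stable and \<open>[1..<N]\<close> is increasing, ties are broken in
  favour of the smaller integer. Only the components \<open>z 1, ..., z (l - 1)\<close> are used.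
\<close>

definition cbc_candidates ::
    "real \<Rightarrow> (nat \<Rightarrow> real) \<Rightarrow> real \<Rightarrow> nat \<Rightarrow> nat \<Rightarrow> (nat \<Rightarrow> nat) \<Rightarrow> nat set" where
  "cbc_candidates \<alpha> \<gamma> \<tau> N l z =
     set (take (nat \<lceil>\<tau> * (real N - 1)\<rceil>)
       (sort_key (\<lambda>c. lattice_R l \<alpha> \<gamma> N (z(l := c))) [1..<N]))"

definition cbc_vectors ::
    "nat \<Rightarrow> real \<Rightarrow> (nat \<Rightarrow> real) \<Rightarrow> real \<Rightarrow> nat \<Rightarrow> (nat \<Rightarrow> nat) set" where
  "cbc_vectors s \<alpha> \<gamma> \<tau> N =
     {z \<in> PiE {1..s} (\<lambda>_. {1..N - 1}).
        z 1 = 1 \<and> (\<forall>l\<in>{2..s}. z l \<in> cbc_candidates \<alpha> \<gamma> \<tau> N l z)}"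

text \<open>The supremum is taken in \<^typ>\<open>ereal\<close>, so that an upper bound on it includes its finiteness.\<close>

definition rand_error ::
    "nat \<Rightarrow> real \<Rightarrow> (nat \<Rightarrow> real) \<Rightarrow> nat \<Rightarrow> real \<Rightarrow> ereal" where
  "rand_error s \<alpha> \<gamma> M \<tau> =
     (SUP f\<in>{f \<in> korobov_space s \<alpha> \<gamma>. korobov_norm s \<alpha> \<gamma> f \<le> 1}.
        ereal (1 / real (card (primes_M M)) *
          (\<Sum>N\<in>primes_M M. 1 / real (card (cbc_vectors s \<alpha> \<gamma> \<tau> N)) *
            (\<Sum>z\<in>cbc_vectors s \<alpha> \<gamma> \<tau> N.
               \<bar>qmc_rule f (lattice_points s N z) - cube_integral s f\<bar>))))"

definition weight_sum :: "nat \<Rightarrow> real \<Rightarrow> (nat \<Rightarrow> real) \<Rightarrow> real \<Rightarrow> real" where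
  "weight_sum s \<alpha> \<gamma> l =
     (\<Sum>u\<in>Pow {1..s} - {{}}. (\<Prod>j\<in>u. \<gamma> j) powr (1 / l) * (2 * riemann_zeta (\<alpha> / l)) ^ card u)"

end

theory Submission
  imports Defs "HOL-Real_Asymp.Real_Asymp"
begin

text \<open>
  By orthogonality of characters, the error of a single rule is at most the sum of
  \<open>norm (fourier_coeff s f k)\<close> over the nonzero frequencies of the dual lattice. Averaging over
  \<open>N\<close> and \<open>z\<close> weights the frequency \<open>k\<close> with the probability \<open>p k\<close> that \<open>k\<close> is dual, and the
  Cauchy-Schwarz inequality reduces the theorem to a bound on \<open>\<Sum>k. (p k / r k)\<^sup>2\<close>.

  We have \<open>p k \<le> p1 k + p2 k\<close>, where \<open>p1\<close> counts the pairs with \<open>N\<close> not dividing \<open>k\<close> and \<open>p2\<close> is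
  the proportion of primes \<open>N\<close> that divide \<open>k\<close>. Since \<open>p1\<close> is at most \<open>4 / (\<tau> M)\<close>, its contribution
  is at most \<open>4 / (\<tau> M)\<close> times a uniform bound on the figure of merit \<open>R\<close>; such a bound follows from
  the usual averaging argument for component-by-component constructions, with Markov's inequality
  in place of the choice of the best component. The contribution of \<open>p2\<close> involves only frequencies
  in \<open>N \<int>\<^sup>s\<close> and pairs of primes; it is of size \<open>M powr (- (2 * \<alpha>)) / card (primes_M M)\<close>, and
  Chebyshev's lower bound for the number of primes in \<open>(M/2, M]\<close> (in the form of Erdos's proof of
  Bertrand's postulate) turns this into the claimed rate. The loss \<open>\<delta>\<close> pays for the logarithm in
  Chebyshev's bound.
\<close>

section \<open>Chebyshev's lower bound for primes between \<open>n\<close> and \<open>2 n\<close>\<close>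

lemma prod_primes_dvd:
  fixes m :: nat
  assumes "finite A" "\<And>p. p \<in> A \<Longrightarrow> prime p \<and> p dvd m"
  shows "\<Prod>A dvd m"
  using assms
proof (induction A rule: finite_induct)
  case (insert p A)
  have "coprime p (\<Prod>A)"
    by (rule prod_coprime_right) (use insert in \<open>auto intro!: primes_coprime\<close>)
  with insert show ?case
    by (auto intro: divides_mult)
qed simp

text \<open>The coefficients at \<open>m\<close> and \<open>m + 1\<close> coincide, and together
  they are at most the row sum \<open>2 * 4 ^ m\<close>.\<close>

lemma choose_odd_le: "(2*m+1) choose m \<le> 4 ^ m"
proof -
  have "((2*m+1) choose m) + ((2*m+1) choose (m+1)) = (\<Sum>k\<in>{m,m+1}. (2*m+1) choose k)"
    by simp
  also have "\<dots> \<le> (\<Sum>k\<le>2*m+1. (2*m+1) choose k)"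
    by (rule sum_mono2) auto
  also have "\<dots> = 2 * 4 ^ m"
    by (subst choose_row_sum) (simp add: power_mult)
  finally show ?thesis
    using binomial_symmetric[of m "2*m+1"] by simp
qed

text \<open>\<open>p\<close> divides \<open>fact n\<close> but neither \<open>fact k\<close> nor
  \<open>fact (n - k)\<close>, so it survives in the quotient.\<close>

lemma prime_dvd_choose:
  fixes p :: nat
  assumes "prime p" "k \<le> n" "p \<le> n" "k < p" "n - k < p"
  shows "p dvd n choose k"
proof -
  have "p dvd fact k * fact (n - k) * (n choose k)"
    using assms by (simp add: binomial_fact_lemma prime_dvd_fact_iff)
  with assms show ?thesis
    by (simp add: prime_dvd_mult_iff prime_dvd_fact_iff)
qed

text \<open>Erdos's induction. An even \<open>n > 2\<close> is not prime and adds nothing. For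
  \<open>n = 2*m+1\<close> the primes in \<open>(m+1, n]\<close> all divide the middle binomial
  coefficient, which is at most \<open>4 ^ m\<close>; the primes up to \<open>m + 1\<close> are
  covered by the induction hypothesis.\<close>

lemma primorial_le: "\<Prod>{p. prime p \<and> p \<le> n} \<le> 4 ^ n" for n :: nat
proof (induction n rule: less_induct)
  case (less n)
  consider "n \<le> 2" | "n > 2" "even n" | m where "n = 2*m+1" "m > 0"
    by (metis One_nat_def even_Suc gr0I nat_le_linear not_less oddE mult_0_right add.left_neutral one_le_numeral)
  then show ?case
  proof cases
    case 1
    show ?thesis
    proof (cases "n = 2")
      case True
      have "{p. prime p \<and> p \<le> (2::nat)} = {2}"
        using prime_ge_2_nat by (auto simp: le_antisym)
      with True show ?thesis by simp
    next
      case False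
      have "\<Prod>{p. prime p \<and> p \<le> n} = 1"
      proof (rule prod.neutral, rule ballI)
        fix p assume "p \<in> {p. prime p \<and> p \<le> n}"
        then have "2 \<le> p" "p \<le> n" using prime_ge_2_nat by blast+
        with 1 False show "p = 1" by linarith
      qed
      then show ?thesis by simp
    qed
  next
    case 2
    have "{p. prime p \<and> p \<le> n} = {p. prime p \<and> p \<le> n - 1}"
      using 2 by (auto simp: le_less dest: prime_odd_nat)
    then have "\<Prod>{p. prime p \<and> p \<le> n} \<le> 4 ^ (n - 1)"
      using less[of "n - 1"] 2 by simp
    also have "\<dots> \<le> 4 ^ n" by (rule power_increasing) auto
    finally show ?thesis .
  next
    case 3
    let ?A = "{p. prime p \<and> p \<le> m + 1}" and ?B = "{p. prime p \<and> m + 1 < p \<and> p \<le> n}"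
    have "\<Prod>?B dvd n choose m"
      by (rule prod_primes_dvd) (use 3 in \<open>auto intro!: prime_dvd_choose\<close>)
    then have B: "\<Prod>?B \<le> 4 ^ m"
      using choose_odd_le[of m] 3 by (auto dest!: dvd_imp_le)
    have "{p. prime p \<and> p \<le> n} = ?A \<union> ?B"
      using 3 by auto
    then have "\<Prod>{p. prime p \<and> p \<le> n} = \<Prod>?A * \<Prod>?B"
      by (simp only:) (rule prod.union_disjoint, auto)
    also have "\<dots> \<le> 4 ^ (m + 1) * 4 ^ m"
      by (intro mult_mono B less) (use 3 in auto)
    also have "\<dots> = 4 ^ n"
      using 3 by (simp flip: power_add)
    finally show ?thesis .
  qed
qed

section \<open>Prime factors of the central binomial coefficient\<close>

lemma legendre_formula:
  fixes p :: nat
  assumes "prime p" "n < p ^ Suc K"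
  shows "multiplicity p (fact n :: nat) = (\<Sum>i=1..K. n div p ^ i)"
  using assms(2)
proof (induction n)
  case 0
  then show ?case by simp
next
  case (Suc n)
  have pge: "p > 1" using assms(1) prime_gt_1_nat by blast
  have le: "multiplicity p (Suc n) \<le> K"
  proof -
    have "p ^ multiplicity p (Suc n) \<le> Suc n"
      by (rule dvd_imp_le) (auto simp: multiplicity_dvd)
    with Suc.prems have "p ^ multiplicity p (Suc n) < p ^ Suc K" by linarith
    with pge show ?thesis by (simp add: power_strict_increasing_iff del: power_Suc)
  qed
  have "multiplicity p (fact (Suc n) :: nat) = multiplicity p (Suc n) + multiplicity p (fact n :: nat)"
    unfolding fact_Suc using assms(1)
    by (subst prime_elem_multiplicity_mult_distrib) (auto simp del: of_nat_Suc)
  also have "multiplicity p (Suc n) = card {i\<in>{1..K}. p ^ i dvd Suc n}"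
  proof -
    have "{i\<in>{1..K}. p ^ i dvd Suc n} = {1..multiplicity p (Suc n)}"
      using le pge by (auto simp: power_dvd_iff_le_multiplicity)
    then show ?thesis by simp
  qed
  also have "\<dots> = (\<Sum>i=1..K. if p ^ i dvd Suc n then 1 else 0)"
    by (simp add: sum.If_cases Int_def)
  also have "multiplicity p (fact n :: nat) = (\<Sum>i=1..K. n div p ^ i)"
    using Suc by simp
  \<comment> \<open>From \<open>n\<close> to \<open>Suc n\<close> the quotient by
    \<open>p ^ i\<close> grows by one exactly when \<open>p ^ i\<close> divides
    \<open>Suc n\<close>.\<close>
  also have "(\<Sum>i=1..K. if p ^ i dvd Suc n then 1 else 0) + (\<Sum>i=1..K. n div p ^ i)
      = (\<Sum>i=1..K. Suc n div p ^ i)"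
    unfolding sum.distrib[symmetric]
    by (intro sum.cong) (auto simp: div_Suc dvd_eq_mod_eq_0)
  finally show ?case .
qed

lemma multiplicity_central_binomial:
  fixes p :: nat
  assumes "prime p" "2 * n < p ^ Suc K"
  shows "multiplicity p (2 * n choose n) = (\<Sum>i=1..K. 2 * n div p ^ i - 2 * (n div p ^ i))"
proof -
  have "(fact (2 * n) :: nat) = fact n * fact n * (2 * n choose n)"
    using binomial_fact_lemma[of n "2 * n"] by simp
  then have "multiplicity p (fact (2 * n) :: nat)
      = 2 * multiplicity p (fact n :: nat) + multiplicity p (2 * n choose n)"
    using assms(1) by (simp add: prime_elem_multiplicity_mult_distrib)
  moreover have "multiplicity p (fact (2 * n) :: nat) = (\<Sum>i=1..K. 2 * n div p ^ i)"
    by (rule legendre_formula) (use assms in auto)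
  moreover have "multiplicity p (fact n :: nat) = (\<Sum>i=1..K. n div p ^ i)"
    by (rule legendre_formula) (use assms in auto)
  \<comment> \<open>Subtraction of naturals truncates at 0; this inequality makes each difference in
    the claim a true difference.\<close>
  moreover have "2 * (n div d) \<le> 2 * n div d" for d :: nat
    by (cases "d = 0") (auto simp: less_eq_div_iff_mult_less_eq)
  ultimately show ?thesis
    by (simp add: sum_subtractf_nat sum_distrib_left)
qed

lemma two_div_diff_le_1: "2 * n div d - 2 * (n div d) \<le> (1::nat)"
proof (cases "d = 0")
  case False
  have "n mod d < d" using False by simp
  then have "2 * n < 2 * (n div d * d) + 2 * d"
    using div_mult_mod_eq[of n d] by linarith
  then have "2 * n < (2 * (n div d) + 2) * d"
    by (simp add: algebra_simps)
  then have "2 * n div d < 2 * (n div d) + 2"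
    using False by (subst div_less_iff_less_mult) auto
  then show ?thesis by simp
qed simp

text \<open>Only the exponents \<open>i\<close> with \<open>p ^ i \<le> 2 * n\<close> contribute to
  the multiplicity, and each contributes at most 1, so the multiplicity is at most the largest such
  exponent \<open>L\<close>.\<close>

lemma central_binomial_prime_power_le:
  fixes p :: nat
  assumes "prime p" "n > 0"
  shows "p ^ multiplicity p (2 * n choose n) \<le> 2 * n"
proof -
  have p: "p > 1" using assms(1) prime_gt_1_nat by blast
  obtain L where L: "p ^ L \<le> 2 * n" "2 * n < p ^ Suc L"
    using ex_power_ivl1[of p "2 * n"] p assms(2) by auto
  have "multiplicity p (2 * n choose n) \<le> (\<Sum>i=1..L. 1)"
    unfolding multiplicity_central_binomial[OF assms(1) L(2)]
    by (intro sum_mono two_div_diff_le_1)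
  then have "p ^ multiplicity p (2 * n choose n) \<le> p ^ L"
    using p by (intro power_increasing) auto
  with L show ?thesis by simp
qed

text \<open>For \<open>2 * n / 3 < p \<le> n\<close> the quotients are
  \<open>2 * n div p = 2\<close> and \<open>n div p = 1\<close>, which cancel;
  \<open>2 * n < p\<^sup>2\<close> removes all higher powers.\<close>

lemma central_binomial_multiplicity_large:
  fixes p :: nat
  assumes "prime p" "2 * n < p\<^sup>2" "2 * n < 3 * p" "p \<le> n"
  shows "multiplicity p (2 * n choose n) = 0"
proof -
  have "multiplicity p (2 * n choose n) = 2 * n div p - 2 * (n div p)"
    using multiplicity_central_binomial[of p n 1] assms by (simp add: power2_eq_square)
  moreover have "2 * n div p < 3"
    using assms by (subst div_less_iff_less_mult) (auto simp: prime_gt_0_nat mult.commute)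
  moreover have "n div p \<ge> 1"
    using assms by (simp add: Suc_le_eq div_greater_zero_iff prime_gt_0_nat)
  ultimately show ?thesis by linarith
qed

text \<open>Primes up to the square root of \<open>2 * n\<close> and primes above \<open>n\<close>
  contribute at most \<open>2 * n\<close> each. All others have multiplicity at most 1; those in
  \<open>(2 * n / 3, n]\<close> do not occur, and those below are covered by the primorial
  bound.\<close>

lemma central_binomial_le_primes:
  fixes n :: nat
  assumes "n > 0"
  shows "2 * n choose n \<le> (2 * n) ^ card {p. prime p \<and> p\<^sup>2 \<le> 2 * n} * 4 ^ (2 * n div 3)
           * (2 * n) ^ card {p. prime p \<and> n < p \<and> p \<le> 2 * n}"
proof -
  let ?C = "2 * n choose n" and ?P = "{p. prime p \<and> p \<le> 2 * n}"
  \<comment> \<open>All three factors are at least 1, so for each prime it suffices that one of them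
    dominates its contribution.\<close>
  define a where "a p = (if p\<^sup>2 \<le> 2 * n then 2 * n else 1)" for p
  define b where "b p = (if p \<le> 2 * n div 3 then p else 1)" for p
  define c where "c p = (if n < p then 2 * n else 1)" for p
  have C0: "?C \<noteq> 0" by simp
  have "?C = (\<Prod>p\<in>prime_factors ?C. p ^ multiplicity p ?C)"
    using C0 by (simp add: prime_factorization_nat)
  also have "\<dots> = (\<Prod>p\<in>?P. p ^ multiplicity p ?C)"
  proof (rule prod.mono_neutral_left)
    show "prime_factors ?C \<subseteq> ?P"
    proof
      fix p assume p: "p \<in> prime_factors ?C"
      then have "p dvd fact n * fact (2 * n - n) * ?C" "prime p" by (auto intro: dvd_mult)
      then have "p dvd fact (2 * n)" by (subst (asm) binomial_fact_lemma) auto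
      then show "p \<in> ?P" using \<open>prime p\<close> by (auto simp: prime_dvd_fact_iff)
    qed
  qed (auto simp: prime_factors_multiplicity)
  also have "\<dots> \<le> (\<Prod>p\<in>?P. a p * b p * c p)"
  proof (intro prod_mono conjI zero_le)
    fix p assume "p \<in> ?P"
    then have p: "prime p" "p \<le> 2 * n" "p \<ge> 1" using prime_ge_1_nat by auto
    note le = central_binomial_prime_power_le[OF p(1) assms]
    have abc: "a p \<ge> 1" "b p \<ge> 1" "c p \<ge> 1"
      using assms p by (auto simp: a_def b_def c_def)
    show "p ^ multiplicity p ?C \<le> a p * b p * c p"
    proof (cases "p\<^sup>2 \<le> 2 * n \<or> n < p")
      case True
      then have "2 * n = a p \<or> 2 * n = c p" by (auto simp: a_def c_def)
      then have "2 * n \<le> a p * b p * c p"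
      proof
        assume "2 * n = a p"
        then show ?thesis using abc by (simp add: mult.assoc)
      next
        assume "2 * n = c p"
        then show ?thesis using abc by simp
      qed
      with le show ?thesis by linarith
    next
      case False
      show ?thesis
      proof (cases "p \<le> 2 * n div 3")
        case True
        have "multiplicity p ?C < 2"
        proof (rule ccontr)
          assume "\<not> multiplicity p ?C < 2"
          then have "p ^ 2 \<le> p ^ multiplicity p ?C" using p by (intro power_increasing) auto
          with le False show False by linarith
        qed
        then have "p ^ multiplicity p ?C \<le> p ^ 1" using p by (intro power_increasing) auto
        also have "\<dots> = b p" using True by (simp add: b_def)
        also have "\<dots> \<le> a p * b p * c p" using abc by simp
        finally show ?thesis .
      next
        case False2: False
        then have "multiplicity p ?C = 0"
          using False p by (intro central_binomial_multiplicity_large) auto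
        then show ?thesis using abc by simp
      qed
    qed
  qed
  also have "\<dots> = (\<Prod>p\<in>?P. a p) * (\<Prod>p\<in>?P. b p) * (\<Prod>p\<in>?P. c p)"
    by (simp add: prod.distrib)
  also have "(\<Prod>p\<in>?P. a p) = (2 * n) ^ card {p. prime p \<and> p\<^sup>2 \<le> 2 * n}"
  proof -
    have "{p. prime p \<and> p\<^sup>2 \<le> 2 * n} = {p\<in>?P. p\<^sup>2 \<le> 2 * n}"
      by (auto simp: power2_eq_square intro: order.trans[OF le_square])
    moreover have "(\<Prod>p\<in>?P. a p) = (2 * n) ^ card {p\<in>?P. p\<^sup>2 \<le> 2 * n}"
      by (simp add: a_def prod.If_cases Int_def)
    ultimately show ?thesis by simp
  qed
  also have "(\<Prod>p\<in>?P. b p) = \<Prod>{p. prime p \<and> p \<le> 2 * n div 3}"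
    unfolding b_def by (subst prod.inter_filter[symmetric]) (auto intro!: prod.cong)
  also have "(\<Prod>p\<in>?P. c p) = (2 * n) ^ card {p. prime p \<and> n < p \<and> p \<le> 2 * n}"
  proof -
    have "{p\<in>?P. n < p} = {p. prime p \<and> n < p \<and> p \<le> 2 * n}" by auto
    moreover have "(\<Prod>p\<in>?P. c p) = (2 * n) ^ card {p\<in>?P. n < p}"
      by (simp add: c_def prod.If_cases Int_def)
    ultimately show ?thesis by simp
  qed
  finally show ?thesis
    by (rule order.trans) (intro mult_mono primorial_le, auto)
qed

text \<open>Take logarithms in \<open>4 ^ n \<le> 2 * n * (2 * n choose n)\<close> and insert the
  preceding bound. The primorial part uses up two thirds of \<open>n * ln 4\<close>; the terms
  \<open>1\<close> and \<open>sqrt (2 * n)\<close> come from the factor \<open>2 * n\<close> and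
  from the primes with \<open>p\<^sup>2 \<le> 2 * n\<close>.\<close>

lemma card_primes_lower_bound:
  fixes n :: nat
  assumes "n > 0"
  shows "real (card {p. prime p \<and> n < p \<and> p \<le> 2 * n})
           \<ge> real n * ln 4 / (3 * ln (2 * real n)) - 1 - sqrt (2 * real n)"
proof -
  let ?s = "card {p. prime p \<and> p\<^sup>2 \<le> 2 * n}" and ?c = "card {p. prime p \<and> n < p \<and> p \<le> 2 * n}"
  have s: "real ?s \<le> sqrt (2 * real n)"
  proof -
    have "{p. prime p \<and> p\<^sup>2 \<le> 2 * n} \<subseteq> {1..nat \<lfloor>sqrt (2 * real n)\<rfloor>}"
    proof
      fix p assume "p \<in> {p. prime p \<and> p\<^sup>2 \<le> 2 * n}"
      then have "p \<ge> 1" "real (p\<^sup>2) \<le> real (2 * n)"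
        using prime_ge_1_nat by (auto simp del: of_nat_power)
      then have "real p \<le> sqrt (2 * real n)" by (intro real_le_rsqrt) auto
      with \<open>p \<ge> 1\<close> show "p \<in> {1..nat \<lfloor>sqrt (2 * real n)\<rfloor>}" by (simp add: le_nat_floor)
    qed
    then have "?s \<le> nat \<lfloor>sqrt (2 * real n)\<rfloor>"
      using card_mono[of "{1..nat \<lfloor>sqrt (2 * real n)\<rfloor>}"] by fastforce
    then have "real ?s \<le> real (nat \<lfloor>sqrt (2 * real n)\<rfloor>)" by (rule of_nat_mono)
    also have "\<dots> \<le> sqrt (2 * real n)" by (rule of_nat_floor) simp
    finally show ?thesis .
  qed
  have n: "2 * real n > 1" using assms by linarith
  have "4 ^ n \<le> real (2 * n) * real (2 * n choose n)"
    using central_binomial_lower_bound[OF assms] assms by (simp add: field_simps)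
  also have "\<dots> \<le> real (2 * n) * real ((2 * n) ^ ?s * 4 ^ (2 * n div 3) * (2 * n) ^ ?c)"
    by (intro mult_left_mono of_nat_mono central_binomial_le_primes assms) auto
  also have "\<dots> = (2 * real n) ^ (1 + ?s + ?c) * 4 ^ (2 * n div 3)"
    by (simp add: power_add)
  finally have "ln (4 ^ n) \<le> ln ((2 * real n) ^ (1 + ?s + ?c) * 4 ^ (2 * n div 3))"
    using assms by (intro ln_mono) auto
  then have "real n * ln 4 \<le> (1 + real ?s + real ?c) * ln (2 * real n) + real (2 * n div 3) * ln 4"
    using assms by (simp add: ln_mult ln_realpow algebra_simps)
  moreover have "real (2 * n div 3) * ln 4 \<le> (2 * real n / 3) * ln 4"
    by (intro mult_right_mono) (use of_nat_div_le_of_nat[of "2 * n" 3] in auto)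
  ultimately have "real n / 3 * ln 4 \<le> (1 + real ?s + real ?c) * ln (2 * real n)"
    by linarith
  also have "\<dots> \<le> (1 + sqrt (2 * real n) + real ?c) * ln (2 * real n)"
    by (intro mult_right_mono add_mono s) (use n in auto)
  finally show ?thesis
    using n by (simp add: field_simps)
qed

text \<open>The logarithm is traded for a small power, which is possible from some \<open>n0\<close>
  on. Below \<open>n0\<close> a single prime is enough because
  \<open>n powr (1 - \<epsilon>) \<le> n < n0 + 1\<close>, whence the constant.\<close>

lemma card_primes_powr_lower_bound:
  fixes \<epsilon> :: real
  assumes "\<epsilon> > 0"
  shows "\<exists>c>0. \<forall>n. {p. prime p \<and> n < p \<and> p \<le> 2 * n} \<noteq> {} \<longrightarrow>
           c * real n powr (1 - \<epsilon>) \<le> real (card {p. prime p \<and> n < p \<and> p \<le> 2 * n})"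
proof -
  let ?P = "\<lambda>n::nat. {p. prime p \<and> n < p \<and> p \<le> 2 * n}"
  have "eventually (\<lambda>n::nat. real n powr (1 - \<epsilon>) \<le> real n * ln 4 / (3 * ln (2 * real n)) - 1 - sqrt (2 * real n)) at_top"
    using assms by real_asymp
  then obtain n0 where n0: "\<And>n. n \<ge> n0 \<Longrightarrow>
      real n powr (1 - \<epsilon>) \<le> real n * ln 4 / (3 * ln (2 * real n)) - 1 - sqrt (2 * real n)"
    by (auto simp: eventually_at_top_linorder)
  show ?thesis
  proof (intro exI[of _ "1 / (real n0 + 1)"] conjI allI impI)
    show "0 < 1 / (real n0 + 1)" by simp
    fix n assume ne: "?P n \<noteq> {}"
    then have n: "n > 0" by auto
    show "1 / (real n0 + 1) * real n powr (1 - \<epsilon>) \<le> real (card (?P n))"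
    proof (cases "n \<ge> n0")
      case True
      have "1 / (real n0 + 1) * real n powr (1 - \<epsilon>) \<le> 1 * real n powr (1 - \<epsilon>)"
        by (intro mult_right_mono) auto
      also have "\<dots> \<le> real (card (?P n))"
        using n0[OF True] card_primes_lower_bound[OF n] by linarith
      finally show ?thesis .
    next
      case False
      have "real n powr (1 - \<epsilon>) \<le> real n powr 1"
        using n assms by (intro powr_mono) auto
      then have "1 / (real n0 + 1) * real n powr (1 - \<epsilon>) \<le> 1"
        using False n by (simp add: field_simps)
      also have "1 \<le> real (card (?P n))"
        using ne by (simp add: Suc_le_eq card_gt_0_iff)
      finally show ?thesis .
    qed
  qed
qed

section \<open>Sums of powers of the weights\<close>

lemma summable_on_prod_PiE:
  fixes h :: "'a \<Rightarrow> 'b \<Rightarrow> real"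
  assumes "finite J" "\<And>j. j \<in> J \<Longrightarrow> h j summable_on B j" "\<And>j x. h j x \<ge> 0"
  shows "(\<lambda>k. \<Prod>j\<in>J. h j (k j)) summable_on PiE J B"
proof (rule nonneg_bdd_above_summable_on)
  show "bdd_above (sum (\<lambda>k. \<Prod>j\<in>J. h j (k j)) ` {F. F \<subseteq> PiE J B \<and> finite F})"
  proof (rule bdd_aboveI2)
    fix F assume F: "F \<in> {F. F \<subseteq> PiE J B \<and> finite F}"
    \<comment> \<open>\<open>F\<close> lies in the finite box of its coordinate projections, and the
      sum over a box factorises.\<close>
    define C where "C j = (\<lambda>k. k j) ` F" for j
    have "(\<Sum>k\<in>F. \<Prod>j\<in>J. h j (k j)) \<le> (\<Sum>k\<in>PiE J C. \<Prod>j\<in>J. h j (k j))"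
      using F assms by (intro sum_mono2 finite_PiE prod_nonneg) (auto simp: C_def PiE_def)
    also have "\<dots> = (\<Prod>j\<in>J. sum (h j) (C j))"
      using F assms by (subst prod_sum_PiE) (auto simp: C_def)
    also have "\<dots> \<le> (\<Prod>j\<in>J. infsum (h j) (B j))"
      using F assms by (intro prod_mono conjI sum_nonneg finite_sum_le_infsum) (auto simp: C_def PiE_def Pi_def)
    finally show "(\<Sum>k\<in>F. \<Prod>j\<in>J. h j (k j)) \<le> (\<Prod>j\<in>J. infsum (h j) (B j))" .
  qed
qed (use assms in \<open>auto intro: prod_nonneg\<close>)

lemma has_sum_prod_PiE:
  fixes h :: "'a \<Rightarrow> 'b \<Rightarrow> real"
  assumes "finite J" "\<And>j. j \<in> J \<Longrightarrow> (h j has_sum S j) (B j)" "\<And>j x. h j x \<ge> 0"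
  shows "((\<lambda>k. \<Prod>j\<in>J. h j (k j)) has_sum (\<Prod>j\<in>J. S j)) (PiE J B)"
proof -
  have sm: "h j summable_on B j" if "j \<in> J" for j
    using assms(2)[OF that] by (rule has_sum_imp_summable)
  have "infsum (\<lambda>k. \<Prod>j\<in>J. h j (k j)) (PiE J B) = (\<Prod>j\<in>J. infsum (h j) (B j))"
    by (rule infsum_prod_PiE_abs) (use sm assms in \<open>auto\<close>)
  also have "\<dots> = (\<Prod>j\<in>J. S j)"
    by (intro prod.cong refl infsumI assms)
  finally show ?thesis
    using summable_on_prod_PiE[OF assms(1) sm assms(3)] by (simp add: has_sum_iff)
qed

lemma has_sum_sum_finite:
  fixes f :: "'i \<Rightarrow> 'a \<Rightarrow> 'b::topological_comm_monoid_add"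
  assumes "finite I" "\<And>i. i \<in> I \<Longrightarrow> (f i has_sum S i) A"
  shows "((\<lambda>x. \<Sum>i\<in>I. f i x) has_sum (\<Sum>i\<in>I. S i)) A"
  using assms by (induction I rule: finite_induct) (auto intro!: has_sum_add)

text \<open>Each term satisfies \<open>a x = a x powr p * a x powr (1 - p)\<close>, and the second factor is at most
  the corresponding power of the whole sum.\<close>

lemma infsum_le_infsum_powr:
  fixes a :: "'a \<Rightarrow> real"
  assumes p: "0 < p" "p \<le> 1" and nn: "\<And>x. x \<in> A \<Longrightarrow> a x \<ge> 0"
    and sm: "(\<lambda>x. a x powr p) summable_on A"
  shows "a summable_on A" "infsum a A \<le> (\<Sum>\<^sub>\<infinity>x\<in>A. a x powr p) powr (1 / p)"
proof -
  define S where "S = (\<Sum>\<^sub>\<infinity>x\<in>A. a x powr p)"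
  have S0: "S \<ge> 0" unfolding S_def by (rule infsum_nonneg) auto
  have le: "a x \<le> a x powr p * S powr ((1 - p) / p)" if x: "x \<in> A" for x
  proof -
    have "a x powr p = (\<Sum>y\<in>{x}. a y powr p)" by simp
    also have "\<dots> \<le> S"
      unfolding S_def by (rule finite_sum_le_infsum[OF sm]) (use x in auto)
    finally have "(a x powr p) powr ((1 - p) / p) \<le> S powr ((1 - p) / p)"
      by (intro powr_mono2) (use p in auto)
    then have "a x powr (1 - p) \<le> S powr ((1 - p) / p)"
      using p by (simp add: powr_powr)
    then have "a x powr p * a x powr (1 - p) \<le> a x powr p * S powr ((1 - p) / p)"
      by (intro mult_left_mono) auto
    then show ?thesis
      using nn[OF x] by (simp flip: powr_add)
  qed
  have sm': "(\<lambda>x. a x powr p * S powr ((1 - p) / p)) summable_on A"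
    by (rule summable_on_cmult_left[OF sm])
  show 1: "a summable_on A"
    by (rule summable_on_comparison_test[OF sm']) (use le nn in auto)
  have "infsum a A \<le> (\<Sum>\<^sub>\<infinity>x\<in>A. a x powr p * S powr ((1 - p) / p))"
    by (rule infsum_mono[OF 1 sm' le])
  also have "\<dots> = S powr 1 * S powr ((1 - p) / p)"
    using S0 by (simp add: infsum_cmult_left' S_def)
  also have "\<dots> = S powr (1 / p)"
    unfolding powr_add[symmetric] using p by (simp add: field_simps)
  finally show "infsum a A \<le> S powr (1 / p)" .
qed

text \<open>Write \<open>t powr e = t * t powr (e - 1)\<close> and enlarge the second factor. This
  later merges the bounds from successive steps of the construction into one power.\<close>

lemma powr_superadditive:
  fixes x y e :: real
  assumes "x \<ge> 0" "y \<ge> 0" "e \<ge> 1"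
  shows "x powr e + y powr e \<le> (x + y) powr e"
proof -
  have split: "t powr e = t * t powr (e - 1)" if "t \<ge> 0" for t :: real
    using that powr_add[of t 1 "e - 1"] by simp
  have "x * x powr (e - 1) + y * y powr (e - 1)
      \<le> x * (x + y) powr (e - 1) + y * (x + y) powr (e - 1)"
    using assms by (intro add_mono mult_left_mono powr_mono2) auto
  then show ?thesis
    using assms split[of x] split[of y] split[of "x + y"] by (simp add: algebra_simps)
qed

section \<open>Zeta values as sums over nonzero integers\<close>

lemma summable_zeta: "a > 1 \<Longrightarrow> summable (\<lambda>n. 1 / real (Suc n) powr a)"
  using summable_real_powr_iff[of "-a"]
  by (subst summable_Suc_iff) (auto simp: powr_minus_divide)

lemma riemann_zeta_nonneg: "riemann_zeta a \<ge> 0" if "a > 1"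
  unfolding riemann_zeta_def by (rule suminf_nonneg[OF summable_zeta[OF that]]) auto

lemma riemann_zeta_antimono: "1 < a \<Longrightarrow> a \<le> b \<Longrightarrow> riemann_zeta b \<le> riemann_zeta a"
  unfolding riemann_zeta_def
  by (intro suminf_le summable_zeta divide_left_mono powr_mono) auto

lemma has_sum_zeta_int:
  assumes "a > 1"
  shows "((\<lambda>m::int. 1 / \<bar>real_of_int m\<bar> powr a) has_sum 2 * riemann_zeta a) (UNIV - {0})"
proof -
  let ?f = "\<lambda>m::int. 1 / \<bar>real_of_int m\<bar> powr a"
  have "((\<lambda>n. 1 / real (Suc n) powr a) has_sum riemann_zeta a) UNIV"
    unfolding riemann_zeta_def
    by (rule sums_nonneg_imp_has_sum) (use summable_zeta[OF assms] in \<open>auto intro: summable_sums\<close>)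
  then have 1: "(?f has_sum riemann_zeta a) {0<..}" 
    by (rule has_sum_reindex_bij_witness[where i = "\<lambda>m. nat m - 1" and j = "\<lambda>n. int (Suc n)", THEN iffD1, rotated -1])
       auto
  then have 2: "(?f has_sum riemann_zeta a) {..<0}" 
    by (rule has_sum_reindex_bij_witness[where j = uminus and i = uminus, THEN iffD1, rotated -1]) auto
  have "(?f has_sum (riemann_zeta a + riemann_zeta a)) ({0<..} \<union> {..<0})"
    by (rule has_sum_Un_disjoint[OF 1 2]) auto
  also have "{0<..} \<union> {..<0} = UNIV - {0::int}" by auto
  finally show ?thesis by simp
qed

lemma has_sum_zeta_int_multiples:
  assumes "a > 1" "N > 0"
  shows "((\<lambda>m::int. 1 / \<bar>real_of_int m\<bar> powr a) has_sum 2 * riemann_zeta a / real N powr a)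
           {m. m \<noteq> 0 \<and> int N dvd m}"
proof -
  have "((\<lambda>m::int. 1 / \<bar>real_of_int m\<bar> powr a * (1 / real N powr a)) has_sum
      2 * riemann_zeta a * (1 / real N powr a)) (UNIV - {0})"
    by (rule has_sum_cmult_left[OF has_sum_zeta_int[OF assms(1)]])
  then have "((\<lambda>m::int. 1 / \<bar>real_of_int m\<bar> powr a) has_sum
      2 * riemann_zeta a * (1 / real N powr a)) {m. m \<noteq> 0 \<and> int N dvd m}"
    by (rule has_sum_reindex_bij_witness[where i = "\<lambda>m. m div int N" and j = "\<lambda>m. int N * m", THEN iffD1, rotated -1])
       (use assms in \<open>auto simp: abs_mult powr_mult\<close>)
  then show ?thesis by simp
qed

section \<open>Reciprocal Korobov weights and their power sums\<close>

definition korobov_w :: "nat \<Rightarrow> real \<Rightarrow> (nat \<Rightarrow> real) \<Rightarrow> (nat \<Rightarrow> int) \<Rightarrow> real" where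
  "korobov_w l \<alpha> \<gamma> k = (\<Prod>j=1..l. if k j = 0 then 1 else \<gamma> j / \<bar>real_of_int (k j)\<bar> powr \<alpha>)"

text \<open>If a weight vanishes under a nonzero entry, both sides are 0 by
  \<open>x / 0 = 0\<close>. Running over all coordinates, with factor 1 at zero entries,
  \<open>korobov_w\<close> lets sums over frequencies factorise.\<close>

lemma inverse_korobov_r: "1 / korobov_r l \<alpha> \<gamma> k = korobov_w l \<alpha> \<gamma> k"
proof -
  have "1 / korobov_r l \<alpha> \<gamma> k = (\<Prod>j\<in>{j\<in>{1..l}. k j \<noteq> 0}. \<gamma> j / \<bar>real_of_int (k j)\<bar> powr \<alpha>)"
    unfolding korobov_r_def by (simp add: prod_dividef)
  also have "\<dots> = korobov_w l \<alpha> \<gamma> k"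
    unfolding korobov_w_def by (subst prod.inter_filter) (auto intro!: prod.cong)
  finally show ?thesis .
qed

locale weights =
  fixes \<alpha> :: real and \<gamma> :: "nat \<Rightarrow> real"
  assumes alpha: "1 / 2 < \<alpha>"
    and weights_bounds: "\<And>j. j \<ge> 1 \<Longrightarrow> 0 \<le> \<gamma> j \<and> \<gamma> j \<le> 1"
begin

abbreviation w :: "nat \<Rightarrow> (nat \<Rightarrow> int) \<Rightarrow> real" where "w l \<equiv> korobov_w l \<alpha> \<gamma>"

lemma w_nonneg: "w l k \<ge> 0"
  unfolding korobov_w_def using weights_bounds by (intro prod_nonneg) auto

lemma w_powr:
  "w l k powr q = (\<Prod>j=1..l. if k j = 0 then 1 else \<gamma> j powr q / \<bar>real_of_int (k j)\<bar> powr (\<alpha> * q))"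
  unfolding korobov_w_def using weights_bounds
  by (subst prod_powr_distrib) (auto intro!: prod.cong simp: powr_divide powr_powr)

text \<open>For \<open>0 < e < \<alpha>\<close>, the sum of
  \<open>(\<gamma> j / \<bar>m\<bar> powr \<alpha>) powr (1 / e)\<close> over all nonzero integers
  \<open>m\<close>.\<close>

definition coord_sum :: "real \<Rightarrow> nat \<Rightarrow> real" where
  "coord_sum e j = \<gamma> j powr (1 / e) * (2 * riemann_zeta (\<alpha> / e))"

lemma coord_sum_nonneg: "0 < e \<Longrightarrow> e < \<alpha> \<Longrightarrow> coord_sum e j \<ge> 0"
  unfolding coord_sum_def by (intro mult_nonneg_nonneg) (auto intro: riemann_zeta_nonneg)

text \<open>Expanding the product gives one term per subset \<open>u\<close>; the \<open>1\<close>
  removed belongs to the empty set. The product form yields the recursion in \<open>l\<close> on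
  which the induction over components rests.\<close>

lemma weight_sum_eq_prod: "weight_sum l \<alpha> \<gamma> e = (\<Prod>j=1..l. 1 + coord_sum e j) - 1"
proof -
  have "(\<Prod>j=1..l. coord_sum e j + 1) = (\<Sum>u\<in>Pow {1..l}. \<Prod>j\<in>u. coord_sum e j)"
    by (simp add: prod_add)
  also have "\<dots> = 1 + (\<Sum>u\<in>Pow {1..l} - {{}}. \<Prod>j\<in>u. coord_sum e j)"
    by (subst sum.remove[of _ "{}"]) auto
  also have "(\<Sum>u\<in>Pow {1..l} - {{}}. \<Prod>j\<in>u. coord_sum e j) = weight_sum l \<alpha> \<gamma> e"
    unfolding weight_sum_def
  proof (intro sum.cong refl)
    fix u assume u: "u \<in> Pow {1..l} - {{}}"
    have "(\<Prod>j\<in>u. \<gamma> j) powr (1 / e) = (\<Prod>j\<in>u. \<gamma> j powr (1 / e))"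
      using u weights_bounds by (subst prod_powr_distrib) auto
    then show "(\<Prod>j\<in>u. coord_sum e j) = (\<Prod>j\<in>u. \<gamma> j) powr (1 / e) * (2 * riemann_zeta (\<alpha> / e)) ^ card u"
      by (simp add: coord_sum_def prod.distrib)
  qed
  finally show ?thesis by (simp add: add.commute)
qed

lemma weight_sum_nonneg: "0 < e \<Longrightarrow> e < \<alpha> \<Longrightarrow> weight_sum l \<alpha> \<gamma> e \<ge> 0"
  unfolding weight_sum_eq_prod by (simp add: prod_ge_1 coord_sum_nonneg)

lemma coord_sum_mono:
  assumes "0 < e" "e \<le> e'" "e' < \<alpha>" "j \<ge> 1"
  shows "coord_sum e j \<le> coord_sum e' j"
  unfolding coord_sum_def
proof (rule mult_mono)
  show "\<gamma> j powr (1 / e) \<le> \<gamma> j powr (1 / e')"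
    using assms weights_bounds[of j] by (intro powr_mono') (auto simp: frac_le)
  show "2 * riemann_zeta (\<alpha> / e) \<le> 2 * riemann_zeta (\<alpha> / e')"
    using assms by (auto intro!: riemann_zeta_antimono simp: divide_left_mono)
qed (use assms in \<open>auto intro: riemann_zeta_nonneg\<close>)

text \<open>As the weights are at most 1 and zeta is decreasing, each coordinate factor grows with
  \<open>e\<close>. Hence the infimum in the hypothesis on \<open>M\<close> is the value at
  \<open>1/2\<close>.\<close>

lemma weight_sum_mono:
  assumes "0 < e" "e \<le> e'" "e' < \<alpha>"
  shows "weight_sum l \<alpha> \<gamma> e \<le> weight_sum l \<alpha> \<gamma> e'"
  unfolding weight_sum_eq_prod using assms
  by (intro diff_right_mono prod_mono) (auto intro!: coord_sum_mono add_nonneg_nonneg coord_sum_nonneg)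

lemma has_sum_coord:
  assumes "0 < e" "e < \<alpha>"
  shows "((\<lambda>m::int. \<gamma> j powr (1 / e) / \<bar>real_of_int m\<bar> powr (\<alpha> * (1 / e))) has_sum coord_sum e j) (UNIV - {0})"
  using has_sum_cmult_right[OF has_sum_zeta_int[of "\<alpha> / e"], of "\<gamma> j powr (1 / e)"] assms
  by (simp add: coord_sum_def)

lemma has_sum_w_powr:
  assumes "0 < e" "e < \<alpha>"
  shows "((\<lambda>k. w l k powr (1 / e)) has_sum (\<Prod>j=1..l. 1 + coord_sum e j)) (int_vecs l)"
  unfolding w_powr int_vecs_def
proof (rule has_sum_prod_PiE)
  fix j assume "j \<in> {1..l}"
  let ?f = "\<lambda>m. if m = 0 then 1 else \<gamma> j powr (1 / e) / \<bar>real_of_int m\<bar> powr (\<alpha> * (1 / e))"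
  have "(?f has_sum coord_sum e j) (UNIV - {0})"
    using has_sum_coord[OF assms, of j] by (rule has_sum_cong[THEN iffD1, rotated]) auto
  then have "(?f has_sum (?f 0 + coord_sum e j)) (insert 0 (UNIV - {0}))"
    by (intro has_sum_insert) auto
  then show "((\<lambda>m. if m = 0 then 1 else \<gamma> j powr (1 / e) / \<bar>real_of_int m\<bar> powr (\<alpha> * (1 / e))) has_sum
     (1 + coord_sum e j)) UNIV"
    by (simp add: insert_absorb)
qed auto

abbreviation zero_vec :: "nat \<Rightarrow> nat \<Rightarrow> int" where "zero_vec l \<equiv> \<lambda>j\<in>{1..l}. 0"

lemma w_zero_vec: "w l (zero_vec l) = 1"
  by (auto simp: korobov_w_def intro: prod.neutral)

lemma has_sum_w_powr_nonzero:
  assumes "0 < e" "e < \<alpha>"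
  shows "((\<lambda>k. w l k powr (1 / e)) has_sum weight_sum l \<alpha> \<gamma> e) (int_vecs l - {zero_vec l})"
proof -
  have "((\<lambda>k. w l k powr (1 / e)) has_sum ((\<Prod>j=1..l. 1 + coord_sum e j) - 1)) (int_vecs l - {zero_vec l})"
    by (rule has_sum_Diff[OF has_sum_w_powr[OF assms]])
       (auto simp: has_sum_finite_iff w_zero_vec int_vecs_def simp del: One_nat_def)
  then show ?thesis by (simp add: weight_sum_eq_prod)
qed

lemma w_powr_2: "w l k powr 2 = (w l k)\<^sup>2"
  using w_nonneg by simp

lemma has_sum_w_sq: "((\<lambda>k. (w l k)\<^sup>2) has_sum weight_sum l \<alpha> \<gamma> (1/2)) (int_vecs l - {zero_vec l})"
  using has_sum_w_powr_nonzero[of "1/2" l] alpha by (simp add: w_powr_2)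

text \<open>The inequality between power sums, with exponent \<open>1 / (2 * e)\<close>, applied to
  the squares. It passes from the squares in the figure of merit to the \<open>1 / e\<close>-th
  powers that are averaged later; a gain there is raised to the power \<open>2 * e\<close>.\<close>

lemma infsum_w_sq_le:
  assumes "1 / 2 \<le> e" and sm: "(\<lambda>k. w l k powr (1 / e)) summable_on A"
  shows "(\<lambda>k. (w l k)\<^sup>2) summable_on A"
    "(\<Sum>\<^sub>\<infinity>k\<in>A. (w l k)\<^sup>2) \<le> (\<Sum>\<^sub>\<infinity>k\<in>A. w l k powr (1 / e)) powr (2 * e)"
proof -
  have eq: "((w l k)\<^sup>2) powr (1 / (2 * e)) = w l k powr (1 / e)" for k
    using assms(1) by (simp flip: w_powr_2 add: powr_powr)
  show "(\<lambda>k. (w l k)\<^sup>2) summable_on A"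
    using infsum_le_infsum_powr(1)[of "1 / (2 * e)" A "\<lambda>k. (w l k)\<^sup>2"] assms by (simp add: eq)
  show "(\<Sum>\<^sub>\<infinity>k\<in>A. (w l k)\<^sup>2) \<le> (\<Sum>\<^sub>\<infinity>k\<in>A. w l k powr (1 / e)) powr (2 * e)"
    using infsum_le_infsum_powr(2)[of "1 / (2 * e)" A "\<lambda>k. (w l k)\<^sup>2"] assms by (simp add: eq)
qed

lemma weight_sum_half_le:
  assumes "1 / 2 \<le> e" "e < \<alpha>"
  shows "weight_sum l \<alpha> \<gamma> (1/2) \<le> weight_sum l \<alpha> \<gamma> e powr (2 * e)"
  using infsum_w_sq_le(2)[of e l "int_vecs l - {zero_vec l}"] assms
    infsumI[OF has_sum_w_sq] infsumI[OF has_sum_w_powr_nonzero[of e l]]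
    has_sum_imp_summable[OF has_sum_w_powr_nonzero[of e l]]
  by simp

end

section \<open>The figure of merit along the component-by-component construction\<close>

lemma int_vecs_iff: "k \<in> int_vecs l \<longleftrightarrow> (\<forall>j. j \<notin> {1..l} \<longrightarrow> k j = undefined)"
  by (auto simp: int_vecs_def PiE_def extensional_def)

lemma mem_dual_lattice:
  "k \<in> dual_lattice l N z \<longleftrightarrow> k \<in> int_vecs l \<and> int N dvd (\<Sum>j=1..l. k j * int (z j))"
  by (simp add: dual_lattice_def cong_0_iff)

lemma dual_lattice_cong:
  "(\<And>j. j \<in> {1..l} \<Longrightarrow> z j = z' j) \<Longrightarrow> dual_lattice l N z = dual_lattice l N z'"
  unfolding dual_lattice_def by (metis (no_types, lifting) sum.cong)

lemma lattice_R_cong: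
  "(\<And>j. j \<in> {1..l} \<Longrightarrow> z j = z' j) \<Longrightarrow> lattice_R l \<alpha> \<gamma> N z = lattice_R l \<alpha> \<gamma> N z'"
  unfolding lattice_R_def by (simp only: dual_lattice_cong[of l z z'])

lemma lattice_R_eq:
  "lattice_R l \<alpha> \<gamma> N z = (\<Sum>\<^sub>\<infinity>k\<in>dual_lattice l N z - {\<lambda>j\<in>{1..l}. 0}. (korobov_w l \<alpha> \<gamma> k)\<^sup>2)"
  unfolding lattice_R_def inverse_korobov_r[symmetric] by (simp add: power_divide)

text \<open>\<open>b\<close> is invertible modulo \<open>N\<close>, so two solutions agree modulo
  \<open>N\<close>, which distinct elements of \<open>{1..N - 1}\<close> never do.\<close>

lemma card_congruence_solutions_le_1:
  fixes A :: "nat set"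
  assumes "prime N" "\<not> int N dvd b" "A \<subseteq> {1..N - 1}"
  shows "card {c \<in> A. int N dvd a + b * int c} \<le> 1"
proof -
  have "c = c'" if c: "c \<in> A" "int N dvd a + b * int c" and c': "c' \<in> A" "int N dvd a + b * int c'" for c c'
  proof -
    have "int N dvd (a + b * int c) - (a + b * int c')"
      using c c' by (intro dvd_diff)
    also have "\<dots> = b * (int c - int c')" by (simp add: algebra_simps)
    finally have d: "int N dvd int c - int c'"
      using assms by (simp add: prime_dvd_mult_iff)
    have "c \<in> {1..N - 1}" "c' \<in> {1..N - 1}" using c c' assms by auto
    then have "\<bar>int c - int c'\<bar> < int N" by auto
    then show "c = c'"
      using d zdvd_imp_le[of "int N" "\<bar>int c - int c'\<bar>"] by (cases "c = c'") auto
  qed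
  then show ?thesis by (auto simp: card_le_Suc0_iff_eq finite_subset[OF assms(3)])
qed

text \<open>If an entry at position \<open>i < n\<close> had key above \<open>B\<close>, so would
  all later ones, and the entries with key at most \<open>B\<close> would fit into the first
  \<open>i\<close> places.\<close>

lemma take_sort_key_le:
  fixes f :: "'a \<Rightarrow> 'b::linorder"
  assumes x: "x \<in> set (take n (sort_key f xs))"
    and n: "n \<le> length (filter (\<lambda>y. f y \<le> B) xs)"
  shows "f x \<le> B"
proof (rule ccontr)
  assume gt: "\<not> f x \<le> B"
  let ?ys = "sort_key f xs"
  obtain i where i: "i < n" "i < length ?ys" "?ys ! i = x"
    using x by (auto simp: in_set_conv_nth)
  have "filter (\<lambda>y. f y \<le> B) (drop i ?ys) = []"
  proof (rule filter_False, rule ballI)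
    fix y assume "y \<in> set (drop i ?ys)"
    then obtain m where "m < length (drop i ?ys)" "y = drop i ?ys ! m"
      unfolding in_set_conv_nth by blast
    then have m: "i + m < length ?ys" "y = ?ys ! (i + m)"
      using i by (auto simp: less_diff_conv add.commute)
    have "map f ?ys ! i \<le> map f ?ys ! (i + m)"
      by (rule sorted_nth_mono) (use m in auto)
    then have "f x \<le> f y" using i m by simp
    with gt show "\<not> f y \<le> B" by simp
  qed
  then have "filter (\<lambda>y. f y \<le> B) ?ys = filter (\<lambda>y. f y \<le> B) (take i ?ys)"
    by (metis append_Nil2 append_take_drop_id filter_append)
  then have "length (filter (\<lambda>y. f y \<le> B) ?ys) \<le> i"
    by (metis length_filter_le length_take le_trans min.cobounded2)
  moreover have "length (filter (\<lambda>y. f y \<le> B) ?ys) = length (filter (\<lambda>y. f y \<le> B) xs)"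
    by (metis mset_filter mset_sort size_mset)
  ultimately show False using i n by linarith
qed

lemma korobov_w_Suc:
  "korobov_w (Suc l) \<alpha> \<gamma> k =
     korobov_w l \<alpha> \<gamma> k * (if k (Suc l) = 0 then 1 else \<gamma> (Suc l) / \<bar>real_of_int (k (Suc l))\<bar> powr \<alpha>)"
  by (simp add: korobov_w_def)

section \<open>The part of the figure of merit added by the last coordinate\<close>

context weights
begin

lemma summable_w_sq: "A \<subseteq> int_vecs l \<Longrightarrow> (\<lambda>k. (w l k)\<^sup>2) summable_on A"
  using summable_on_subset[OF has_sum_imp_summable[OF has_sum_w_powr[of "1/2" l]], of A] alpha
  by (simp add: w_powr_2)

lemma summable_w_powr: "0 < e \<Longrightarrow> e < \<alpha> \<Longrightarrow> A \<subseteq> int_vecs l \<Longrightarrow> (\<lambda>k. w l k powr (1 / e)) summable_on A"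
  using summable_on_subset[OF has_sum_imp_summable[OF has_sum_w_powr[of e l]], of A] by simp

text \<open>The only part of \<open>lattice_R l\<close> that changes with the component
  \<open>z l\<close>, so that ranking components by \<open>lattice_R l\<close> is ranking them by
  \<open>R_last l\<close>.\<close>

definition R_last :: "nat \<Rightarrow> nat \<Rightarrow> (nat \<Rightarrow> nat) \<Rightarrow> real" where
  "R_last l N z = (\<Sum>\<^sub>\<infinity>k\<in>{k \<in> dual_lattice l N z. k l \<noteq> 0}. (w l k)\<^sup>2)"

definition R_last_powr :: "real \<Rightarrow> nat \<Rightarrow> nat \<Rightarrow> (nat \<Rightarrow> nat) \<Rightarrow> real" where
  "R_last_powr e l N z = (\<Sum>\<^sub>\<infinity>k\<in>{k \<in> dual_lattice l N z. k l \<noteq> 0}. w l k powr (1 / e))"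

lemma R_last_le:
  assumes "1 / 2 \<le> e" "e < \<alpha>"
  shows "R_last l N z \<le> R_last_powr e l N z powr (2 * e)"
  unfolding R_last_def R_last_powr_def
  by (rule infsum_w_sq_le(2)) (use assms in \<open>auto intro!: summable_w_powr simp: mem_dual_lattice\<close>)

lemma lattice_R_Suc:
  "lattice_R (Suc l) \<alpha> \<gamma> N z = lattice_R l \<alpha> \<gamma> N z + R_last (Suc l) N z"
proof -
  let ?D = "dual_lattice (Suc l) N z"
  let ?A = "{k \<in> ?D. k (Suc l) \<noteq> 0}" and ?B = "{k \<in> ?D - {zero_vec (Suc l)}. k (Suc l) = 0}"
  have "lattice_R (Suc l) \<alpha> \<gamma> N z = (\<Sum>\<^sub>\<infinity>k\<in>?B \<union> ?A. (w (Suc l) k)\<^sup>2)"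
    unfolding lattice_R_eq by (rule arg_cong2[where f = infsum]) auto
  also have "\<dots> = (\<Sum>\<^sub>\<infinity>k\<in>?B. (w (Suc l) k)\<^sup>2) + R_last (Suc l) N z"
    unfolding R_last_def
    by (rule infsum_Un_disjoint) (auto intro!: summable_w_sq simp: mem_dual_lattice)
  also have "(\<Sum>\<^sub>\<infinity>k\<in>?B. (w (Suc l) k)\<^sup>2) = (\<Sum>\<^sub>\<infinity>k\<in>dual_lattice l N z - {zero_vec l}. (w l k)\<^sup>2)"
  \<comment> \<open>Vectors of length \<open>l\<close> take the value \<open>undefined\<close>
    beyond \<open>l\<close>, so dropping a zero last coordinate means overwriting it by
    \<open>undefined\<close>.\<close>
  proof (rule infsum_reindex_bij_witness[where i = "\<lambda>k. k(Suc l := 0)" and j = "\<lambda>k. k(Suc l := undefined)"])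
    fix k assume k: "k \<in> ?B"
    have w: "w l (k(Suc l := undefined)) = w l k"
      unfolding korobov_w_def by (intro prod.cong) auto
    show "(w l (k(Suc l := undefined)))\<^sup>2 = (w (Suc l) k)\<^sup>2"
      unfolding w using k by (simp add: korobov_w_Suc)
    have s: "(\<Sum>j=1..l. (k(Suc l := undefined)) j * int (z j)) = (\<Sum>j=1..l. k j * int (z j))"
      by (intro sum.cong) auto
    have "k(Suc l := undefined) \<noteq> zero_vec l"
    proof
      assume eq: "k(Suc l := undefined) = zero_vec l"
      have "k = zero_vec (Suc l)"
      proof
        fix j
        show "k j = zero_vec (Suc l) j"
          using k fun_cong[OF eq, of j]
          by (cases "j = Suc l") (auto split: if_splits simp: restrict_def)
      qed
      with k show False by simp
    qed
    with k s show "k(Suc l := undefined) \<in> dual_lattice l N z - {zero_vec l}"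
      by (auto simp: mem_dual_lattice int_vecs_iff)
    show "(k(Suc l := undefined))(Suc l := 0) = k"
      using k by auto
  next
    fix k assume k: "k \<in> dual_lattice l N z - {zero_vec l}"
    have s: "(\<Sum>j=1..l. (k(Suc l := 0)) j * int (z j)) = (\<Sum>j=1..l. k j * int (z j))"
      by (intro sum.cong) auto
    have u: "k (Suc l) = undefined" using k by (auto simp: mem_dual_lattice int_vecs_iff)
    then show "(k(Suc l := 0))(Suc l := undefined) = k" by (auto simp: fun_upd_idem)
    have "k(Suc l := 0) \<noteq> zero_vec (Suc l)"
    proof
      assume eq: "k(Suc l := 0) = zero_vec (Suc l)"
      have "k = zero_vec l"
      proof
        fix j
        show "k j = zero_vec l j"
          using u fun_cong[OF eq, of j] by (cases "j = Suc l") (auto split: if_splits simp: restrict_def)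
      qed
      with k show False by simp
    qed
    with k s show "k(Suc l := 0) \<in> ?B"
      by (auto simp: mem_dual_lattice int_vecs_iff)
  qed
  also have "\<dots> = lattice_R l \<alpha> \<gamma> N z"
    by (rule lattice_R_eq[symmetric])
  finally show ?thesis .
qed

lemma lattice_R_0: "lattice_R 0 \<alpha> \<gamma> N z = 0"
proof -
  have "dual_lattice 0 N z - {zero_vec 0} = {}"
    by (auto simp: mem_dual_lattice int_vecs_iff fun_eq_iff)
  then show ?thesis by (simp only: lattice_R_eq infsum_empty)
qed

text \<open>The sum factorises. \<open>D\<close> restricts the last coordinate only, so one
  computation serves both all nonzero integers and the nonzero multiples of
  \<open>N\<close>.\<close>

lemma has_sum_w_powr_last:
  assumes e: "0 < e" "e < \<alpha>" and D: "0 \<notin> D"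
    and S: "((\<lambda>m. \<gamma> (Suc l) powr (1 / e) / \<bar>real_of_int m\<bar> powr (\<alpha> * (1 / e))) has_sum S) D"
  shows "((\<lambda>k. w (Suc l) k powr (1 / e)) has_sum (\<Prod>j=1..l. 1 + coord_sum e j) * S)
           {k \<in> int_vecs (Suc l). k (Suc l) \<in> D}"
proof -
  let ?f = "\<lambda>j m. \<gamma> j powr (1 / e) / \<bar>real_of_int m\<bar> powr (\<alpha> * (1 / e))"
  define h where "h j m = (if m = 0 then 1 else ?f j m)" for j m
  define B where "B j = (if j = Suc l then D else UNIV)" for j
  have "((\<lambda>k. \<Prod>j=1..Suc l. h j (k j)) has_sum
      (\<Prod>j=1..Suc l. if j = Suc l then S else 1 + coord_sum e j)) (PiE {1..Suc l} B)"
  proof (rule has_sum_prod_PiE)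
    fix j assume "j \<in> {1..Suc l}"
    show "(h j has_sum (if j = Suc l then S else 1 + coord_sum e j)) (B j)"
    proof (cases "j = Suc l")
      case True
      have "(h (Suc l) has_sum S) D"
        using S by (rule has_sum_cong[THEN iffD1, rotated]) (use D in \<open>auto simp: h_def\<close>)
      with True show ?thesis by (simp add: B_def)
    next
      case False
      have "(h j has_sum coord_sum e j) (UNIV - {0})"
        using has_sum_coord[OF e, of j] by (rule has_sum_cong[THEN iffD1, rotated]) (auto simp: h_def)
      then have "(h j has_sum (h j 0 + coord_sum e j)) (insert 0 (UNIV - {0}))"
        by (intro has_sum_insert) auto
      with False show ?thesis by (simp add: B_def insert_absorb h_def)
    qed
  qed (auto simp: h_def)
  also have "PiE {1..Suc l} B = {k \<in> int_vecs (Suc l). k (Suc l) \<in> D}"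
    by (auto simp: PiE_def Pi_def B_def int_vecs_def extensional_def)
  also have "(\<Prod>j=1..Suc l. if j = Suc l then S else 1 + coord_sum e j)
      = (\<Prod>j=1..l. 1 + coord_sum e j) * S"
    by (simp add: mult.commute)
  finally show ?thesis
    by (simp only: w_powr h_def)
qed

lemma has_sum_w_powr_last_multiples:
  assumes e: "0 < e" "e < \<alpha>" and N: "N > 0"
  shows "((\<lambda>k. w (Suc l) k powr (1 / e)) has_sum
            (\<Prod>j=1..l. 1 + coord_sum e j) * (coord_sum e (Suc l) / real N powr (\<alpha> / e)))
           {k \<in> int_vecs (Suc l). k (Suc l) \<noteq> 0 \<and> int N dvd k (Suc l)}"
proof -
  have "((\<lambda>m. \<gamma> (Suc l) powr (1 / e) / \<bar>real_of_int m\<bar> powr (\<alpha> * (1 / e))) has_sum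
      coord_sum e (Suc l) / real N powr (\<alpha> / e)) {m. m \<noteq> 0 \<and> int N dvd m}"
    using has_sum_cmult_right[OF has_sum_zeta_int_multiples[of "\<alpha> / e" N], of "\<gamma> (Suc l) powr (1 / e)"] e N
    by (simp add: coord_sum_def)
  from has_sum_w_powr_last[OF e _ this] show ?thesis by simp
qed

lemma prod_coord_sum_nonneg: "0 < e \<Longrightarrow> e < \<alpha> \<Longrightarrow> (\<Prod>j=1..l. 1 + coord_sum e j) \<ge> 0"
  by (intro prod_nonneg) (simp add: coord_sum_nonneg add_nonneg_nonneg)

lemma inverse_powr_le:
  assumes e: "0 < e" "e < \<alpha>" and N: "N > 0"
  shows "1 / real N powr (\<alpha> / e) \<le> 1 / real N"
proof -
  have "real N powr 1 \<le> real N powr (\<alpha> / e)"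
    by (rule powr_mono) (use assms in auto)
  then show ?thesis using N by (intro divide_left_mono) auto
qed

text \<open>Exchange the sums and count the components \<open>c\<close> for which \<open>k\<close>
  is dual: at most one if \<open>N\<close> does not divide the last coordinate, at most
  \<open>N - 1\<close> otherwise. Frequencies of the second kind are rare: their sum carries a
  factor \<open>1 / N powr (\<alpha> / e) \<le> 1 / N\<close>.\<close>

lemma sum_R_last_powr_le:
  assumes e: "0 < e" "e < \<alpha>" and N: "prime N"
  shows "(\<Sum>c=1..N-1. R_last_powr e (Suc l) N (z(Suc l := c)))
           \<le> (real N - 1) * (2 / real N * ((\<Prod>j=1..l. 1 + coord_sum e j) * coord_sum e (Suc l)))"
proof -
  let ?V = "\<lambda>k. w (Suc l) k powr (1 / e)" and ?P = "\<Prod>j=1..l. 1 + coord_sum e j" and ?a = "coord_sum e (Suc l)"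
  let ?I = "int_vecs (Suc l)"
  define B where "B c = {k \<in> dual_lattice (Suc l) N (z(Suc l := c)). k (Suc l) \<noteq> 0}" for c
  define D1 where "D1 = {k \<in> ?I. k (Suc l) \<noteq> 0}"
  define D2 where "D2 = {k \<in> ?I. k (Suc l) \<noteq> 0 \<and> int N dvd k (Suc l)}"
  have N2: "N \<ge> 2" using N prime_ge_2_nat by blast
  have ext: "((\<lambda>k. if k \<in> A then ?V k else 0) has_sum S) ?I" if "(?V has_sum S) A" "A \<subseteq> ?I" for A S
    using that(1) by (rule has_sum_cong_neutral[THEN iffD1, rotated -1]) (use that(2) in auto)
  have B: "((\<lambda>k. if k \<in> B c then ?V k else 0) has_sum R_last_powr e (Suc l) N (z(Suc l := c))) ?I" for c
    unfolding R_last_powr_def B_def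
    by (intro ext has_sum_infsum summable_w_powr[OF e]) (auto simp: mem_dual_lattice)
  have L: "((\<lambda>k. \<Sum>c=1..N-1. if k \<in> B c then ?V k else 0) has_sum
      (\<Sum>c=1..N-1. R_last_powr e (Suc l) N (z(Suc l := c)))) ?I"
    by (intro has_sum_sum_finite B) auto
  have "(?V has_sum ?P * ?a) D1"
    using has_sum_w_powr_last[OF e _ has_sum_coord[OF e]] by (simp add: D1_def)
  then have 1: "((\<lambda>k. if k \<in> D1 then ?V k else 0) has_sum ?P * ?a) ?I"
    by (rule ext) (auto simp: D1_def)
  have "(?V has_sum ?P * (?a / real N powr (\<alpha> / e))) D2"
    unfolding D2_def using N2 by (intro has_sum_w_powr_last_multiples e) auto
  then have 2: "((\<lambda>k. if k \<in> D2 then ?V k else 0) has_sum ?P * (?a / real N powr (\<alpha> / e))) ?I"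
    by (rule ext) (auto simp: D2_def)
  \<comment> \<open>\<open>D1\<close> supplies one count for every frequency with nonzero last
    coordinate; those in \<open>D2\<close> need up to \<open>N - 2\<close> more.\<close>
  have G: "((\<lambda>k. (if k \<in> D1 then ?V k else 0) + (real N - 2) * (if k \<in> D2 then ?V k else 0)) has_sum
      ?P * ?a + (real N - 2) * (?P * (?a / real N powr (\<alpha> / e)))) ?I"
    by (intro has_sum_add has_sum_cmult_right 1 2)
  have "(\<Sum>c=1..N-1. R_last_powr e (Suc l) N (z(Suc l := c)))
      \<le> ?P * ?a + (real N - 2) * (?P * (?a / real N powr (\<alpha> / e)))"
  proof (rule has_sum_mono[OF L G])
    fix k assume k: "k \<in> ?I"
    have "(\<Sum>c=1..N-1. if k \<in> B c then ?V k else 0) = real (card {c\<in>{1..N-1}. k \<in> B c}) * ?V k"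
      by (simp add: sum.If_cases Int_def)
    also have "\<dots> \<le> (if k \<in> D1 then ?V k else 0) + (real N - 2) * (if k \<in> D2 then ?V k else 0)"
    proof (cases "k (Suc l) = 0")
      case True
      then show ?thesis by (simp add: B_def D1_def D2_def)
    next
      case nz: False
      show ?thesis
      proof (cases "int N dvd k (Suc l)")
        case True
        have "card {c\<in>{1..N-1}. k \<in> B c} \<le> card {1..N-1}" by (intro card_mono) auto
        then have "real (card {c\<in>{1..N-1}. k \<in> B c}) \<le> real N - 1" using N2 by simp
        then have "real (card {c\<in>{1..N-1}. k \<in> B c}) * ?V k \<le> (real N - 1) * ?V k"
          by (intro mult_right_mono) auto
        with True nz k show ?thesis by (simp add: D1_def D2_def algebra_simps)
      next
        case False
        have "(\<Sum>j=1..l. k j * int ((z(Suc l := c)) j)) = (\<Sum>j=1..l. k j * int (z j))" for c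
          by (intro sum.cong) auto
        then have "{c\<in>{1..N-1}. k \<in> B c}
            = {c\<in>{1..N-1}. int N dvd (\<Sum>j=1..l. k j * int (z j)) + k (Suc l) * int c}"
          using nz k by (auto simp: B_def mem_dual_lattice)
        then have "card {c\<in>{1..N-1}. k \<in> B c} \<le> 1"
          using card_congruence_solutions_le_1[OF N False, of "{1..N-1}"] by simp
        then have "real (card {c\<in>{1..N-1}. k \<in> B c}) * ?V k \<le> 1 * ?V k"
          by (intro mult_right_mono) auto
        with False nz k show ?thesis by (simp add: D1_def D2_def)
      qed
    qed
    finally show "(\<Sum>c=1..N-1. if k \<in> B c then ?V k else 0)
      \<le> (if k \<in> D1 then ?V k else 0) + (real N - 2) * (if k \<in> D2 then ?V k else 0)" .
  qed
  also have "\<dots> = ?P * ?a * (1 + (real N - 2) * (1 / real N powr (\<alpha> / e)))"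
    by (simp add: algebra_simps)
  also have "\<dots> \<le> ?P * ?a * (1 + (real N - 2) * (1 / real N))"
    using N2 inverse_powr_le[OF e, of N]
    by (intro mult_left_mono add_left_mono mult_nonneg_nonneg prod_coord_sum_nonneg coord_sum_nonneg e) auto
  \<comment> \<open>\<open>1 + (N - 2) / N = 2 * (N - 1) / N\<close>: the mean over the
    \<open>N - 1\<close> components gains the factor \<open>2 / N\<close>.\<close>
  also have "\<dots> = (real N - 1) * (2 / real N * (?P * ?a))"
    using N2 by (simp add: field_simps)
  finally show ?thesis .
qed

end

section \<open>Bounds for all vectors that the construction can produce\<close>

definition cbc_size :: "real \<Rightarrow> nat \<Rightarrow> nat" where
  "cbc_size \<tau> N = nat \<lceil>\<tau> * (real N - 1)\<rceil>"

lemma cbc_size_bounds: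
  assumes "0 < \<tau>" "\<tau> < 1" "N \<ge> 2"
  shows "cbc_size \<tau> N \<le> N - 1" "cbc_size \<tau> N > 0" "\<tau> * (real N - 1) \<le> real (cbc_size \<tau> N)"
proof -
  have "\<tau> * (real N - 1) \<le> 1 * (real N - 1)" using assms by (intro mult_right_mono) auto
  then have "\<lceil>\<tau> * (real N - 1)\<rceil> \<le> int (N - 1)" using assms(3) by (subst ceiling_le_iff) auto
  then show "cbc_size \<tau> N \<le> N - 1" unfolding cbc_size_def by (subst nat_le_iff)
  have "\<tau> * (real N - 1) > 0" using assms by simp
  then show "cbc_size \<tau> N > 0" by (simp add: cbc_size_def)
  show "\<tau> * (real N - 1) \<le> real (cbc_size \<tau> N)" unfolding cbc_size_def by (rule real_nat_ceiling_ge)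
qed

lemma cbc_candidates_subset: "cbc_candidates \<alpha> \<gamma> \<tau> N l z \<subseteq> {1..N - 1}"
  unfolding cbc_candidates_def by (rule order.trans[OF set_take_subset]) auto

lemma card_cbc_candidates:
  assumes "0 < \<tau>" "\<tau> < 1" "N \<ge> 2"
  shows "card (cbc_candidates \<alpha> \<gamma> \<tau> N l z) = cbc_size \<tau> N"
  using cbc_size_bounds(1)[OF assms]
  unfolding cbc_candidates_def cbc_size_def[symmetric]
  by (subst distinct_card) (auto intro!: distinct_take simp: min_def)

lemma cbc_candidates_cong:
  assumes "\<And>j. j \<in> {1..<l} \<Longrightarrow> z j = z' j"
  shows "cbc_candidates \<alpha> \<gamma> \<tau> N l z = cbc_candidates \<alpha> \<gamma> \<tau> N l z'"
proof -
  have "lattice_R l \<alpha> \<gamma> N (z(l := c)) = lattice_R l \<alpha> \<gamma> N (z'(l := c))" for c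
    by (rule lattice_R_cong) (use assms in auto)
  then show ?thesis by (simp add: cbc_candidates_def)
qed

context weights
begin

text \<open>Markov's inequality: fewer than \<open>(1 - \<tau>) (N - 1)\<close> of the \<open>N - 1\<close> components exceed the
  mean by a factor of more than \<open>1 / (1 - \<tau>)\<close>.\<close>

lemma R_last_candidate_le:
  assumes e: "1 / 2 \<le> e" "e < \<alpha>" and N: "prime N" and tau: "0 < \<tau>" "\<tau> < 1"
    and c: "c \<in> cbc_candidates \<alpha> \<gamma> \<tau> N (Suc l) z"
  shows "R_last (Suc l) N (z(Suc l := c))
    \<le> (2 / ((1 - \<tau>) * real N) * ((\<Prod>j=1..l. 1 + coord_sum e j) * coord_sum e (Suc l))) powr (2 * e)"
proof -
  define A where "A = 2 / real N * ((\<Prod>j=1..l. 1 + coord_sum e j) * coord_sum e (Suc l))"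
  define Q where "Q = A / (1 - \<tau>)"
  define \<phi> where "\<phi> c = R_last_powr e (Suc l) N (z(Suc l := c))" for c
  \<comment> \<open>\<open>lattice_R l\<close> does not depend on the component being chosen, so
    \<open>R_last \<le> Q powr (2 * e)\<close> amounts to
    \<open>lattice_R (Suc l) \<le> \<beta>\<close>, a condition on the sorting key.\<close>
  define \<beta> where "\<beta> = lattice_R l \<alpha> \<gamma> N z + Q powr (2 * e)"
  have e0: "0 < e" using e by simp
  have N2: "N \<ge> 2" using N prime_ge_2_nat by blast
  have Q0: "Q \<ge> 0"
    unfolding Q_def A_def using tau e
    by (intro divide_nonneg_nonneg mult_nonneg_nonneg prod_coord_sum_nonneg coord_sum_nonneg) auto
  have \<phi>0: "\<phi> c \<ge> 0" for c
    unfolding \<phi>_def R_last_powr_def by (rule infsum_nonneg) auto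
  have sum: "sum \<phi> {1..N-1} \<le> (real N - 1) * ((1 - \<tau>) * Q)"
    unfolding \<phi>_def using sum_R_last_powr_le[OF e0 e(2) N, of l z] tau by (simp add: Q_def A_def)
  define bad where "bad = {c\<in>{1..N-1}. \<phi> c > Q}"
  define good where "good = {c\<in>{1..N-1}. \<phi> c \<le> Q}"
  have split: "card bad + card good = N - 1"
  proof -
    have "card (bad \<union> good) = card bad + card good"
      by (rule card_Un_disjoint) (auto simp: bad_def good_def)
    moreover have "bad \<union> good = {1..N-1}" by (auto simp: bad_def good_def)
    ultimately show ?thesis by simp
  qed
  have "cbc_size \<tau> N \<le> card good"
  proof (cases "bad = {}")
    case True
    then show ?thesis using split cbc_size_bounds(1)[OF tau N2] by simp
  next
    case False
    have "real (card bad) * Q = (\<Sum>c\<in>bad. Q)" by simp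
    also have "\<dots> < sum \<phi> bad"
      using False by (intro sum_strict_mono) (auto simp: bad_def)
    also have "\<dots> \<le> sum \<phi> {1..N-1}"
      using \<phi>0 by (intro sum_mono2) (auto simp: bad_def)
    finally have "real (card bad) * Q < ((real N - 1) * (1 - \<tau>)) * Q"
      using sum by (simp add: mult.assoc)
    \<comment> \<open>The strict inequality excludes \<open>Q = 0\<close>, so \<open>Q\<close> may
      be cancelled.\<close>
    then have "real (card bad) < (real N - 1) * (1 - \<tau>)"
      using Q0 by (simp add: mult_less_cancel_right)
    moreover have "real (card bad) + real (card good) = real N - 1"
      using split N2 by (simp flip: of_nat_add add: of_nat_diff)
    ultimately have "\<tau> * (real N - 1) \<le> real (card good)" by (simp add: algebra_simps)
    then show ?thesis by (simp add: cbc_size_def ceiling_le_iff nat_le_iff)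
  qed
  also have "card good \<le> card {c \<in> set [1..<N]. lattice_R (Suc l) \<alpha> \<gamma> N (z(Suc l := c)) \<le> \<beta>}"
  proof (rule card_mono)
    show "good \<subseteq> {c \<in> set [1..<N]. lattice_R (Suc l) \<alpha> \<gamma> N (z(Suc l := c)) \<le> \<beta>}"
    proof
      fix c assume "c \<in> good"
      then have c: "c \<in> {1..N-1}" "\<phi> c \<le> Q" by (auto simp: good_def)
      have "R_last (Suc l) N (z(Suc l := c)) \<le> \<phi> c powr (2 * e)"
        unfolding \<phi>_def by (rule R_last_le[OF e])
      also have "\<dots> \<le> Q powr (2 * e)" using c \<phi>0 e0 by (intro powr_mono2) auto
      finally have "lattice_R (Suc l) \<alpha> \<gamma> N (z(Suc l := c)) \<le> lattice_R l \<alpha> \<gamma> N (z(Suc l := c)) + Q powr (2 * e)"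
        by (simp add: lattice_R_Suc)
      also have "lattice_R l \<alpha> \<gamma> N (z(Suc l := c)) = lattice_R l \<alpha> \<gamma> N z"
        by (rule lattice_R_cong) auto
      finally show "c \<in> {c \<in> set [1..<N]. lattice_R (Suc l) \<alpha> \<gamma> N (z(Suc l := c)) \<le> \<beta>}"
        using c N2 by (auto simp: \<beta>_def simp del: fun_upd_apply)
    qed
  qed auto
  also have "\<dots> = length (filter (\<lambda>c. lattice_R (Suc l) \<alpha> \<gamma> N (z(Suc l := c)) \<le> \<beta>) [1..<N])"
    by (subst distinct_length_filter) (auto simp: Int_def conj_commute)
  finally have "lattice_R (Suc l) \<alpha> \<gamma> N (z(Suc l := c)) \<le> \<beta>"
    using take_sort_key_le[of c "cbc_size \<tau> N" "\<lambda>c. lattice_R (Suc l) \<alpha> \<gamma> N (z(Suc l := c))" "[1..<N]" \<beta>] c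
    by (simp add: cbc_candidates_def cbc_size_def)
  moreover have "lattice_R l \<alpha> \<gamma> N (z(Suc l := c)) = lattice_R l \<alpha> \<gamma> N z"
    by (rule lattice_R_cong) auto
  ultimately have "R_last (Suc l) N (z(Suc l := c)) \<le> Q powr (2 * e)"
    by (simp add: lattice_R_Suc \<beta>_def)
  then show ?thesis by (simp add: Q_def A_def mult.commute)
qed

text \<open>Induction over the components. With \<open>K = 2 / ((1 - \<tau>) * N)\<close>, each step
  adds at most \<open>(K * p) powr (2 * e)\<close>, where \<open>p\<close> is exactly the increment
  of \<open>weight_sum\<close>; superadditivity of the power, valid as \<open>2 * e \<ge> 1\<close>,
  merges the terms.\<close>

lemma lattice_R_cbc_le:
  assumes e: "1 / 2 \<le> e" "e < \<alpha>" and N: "prime N" and tau: "0 < \<tau>" "\<tau> < 1"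
    and z: "z \<in> cbc_vectors s \<alpha> \<gamma> \<tau> N" and l: "1 \<le> l" "l \<le> s"
  shows "lattice_R l \<alpha> \<gamma> N z \<le> (2 / ((1 - \<tau>) * real N) * weight_sum l \<alpha> \<gamma> e) powr (2 * e)"
  using l
proof (induction l rule: nat_induct_at_least)
  case base
  have e0: "0 < e" using e by simp
  have N2: "N \<ge> 2" using N prime_ge_2_nat by blast
  let ?V = "\<lambda>k. w 1 k powr (1 / e)"
  have z1: "z 1 = 1" using z by (simp add: cbc_vectors_def)
  \<comment> \<open>With \<open>z 1 = 1\<close> there is no averaging: the dual frequencies are the
    multiples of \<open>N\<close>, and their sum gains the factor
    \<open>1 / N powr (\<alpha> / e)\<close>.\<close>
  have "((\<lambda>k. w (Suc 0) k powr (1 / e)) has_sum (\<Prod>j=1..0. 1 + coord_sum e j) * (coord_sum e (Suc 0) / real N powr (\<alpha> / e)))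
           {k \<in> int_vecs (Suc 0). k (Suc 0) \<noteq> 0 \<and> int N dvd k (Suc 0)}"
    by (rule has_sum_w_powr_last_multiples) (use e0 e N2 in auto)
  moreover have "{k \<in> int_vecs (Suc 0). k (Suc 0) \<noteq> 0 \<and> int N dvd k (Suc 0)} = {k \<in> dual_lattice 1 N z. k 1 \<noteq> 0}"
    using z1 by (auto simp: mem_dual_lattice)
  ultimately have "R_last_powr e 1 N z = coord_sum e 1 * (1 / real N powr (\<alpha> / e))"
    unfolding R_last_powr_def by (intro infsumI) simp
  also have "\<dots> \<le> coord_sum e 1 * (2 / ((1 - \<tau>) * real N))"
  proof (intro mult_left_mono coord_sum_nonneg e0 e)
    have "(1 - \<tau>) * real N \<le> 2 * real N" using tau by (intro mult_right_mono) auto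
    then have "1 / real N \<le> 2 / ((1 - \<tau>) * real N)" using tau N2 by (simp add: field_simps)
    with inverse_powr_le[OF e0 e(2), of N] N2
    show "1 / real N powr (\<alpha> / e) \<le> 2 / ((1 - \<tau>) * real N)" by linarith
  qed
  finally have le: "R_last_powr e 1 N z \<le> 2 / ((1 - \<tau>) * real N) * weight_sum 1 \<alpha> \<gamma> e"
    by (simp add: weight_sum_eq_prod mult.commute)
  have "lattice_R 1 \<alpha> \<gamma> N z = R_last 1 N z"
    using lattice_R_Suc[of 0 N z] by (simp add: lattice_R_0)
  also have "\<dots> \<le> R_last_powr e 1 N z powr (2 * e)" by (rule R_last_le[OF e])
  also have "\<dots> \<le> (2 / ((1 - \<tau>) * real N) * weight_sum 1 \<alpha> \<gamma> e) powr (2 * e)"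
    using le e0 by (intro powr_mono2) (auto simp: R_last_powr_def intro: infsum_nonneg)
  finally show ?case .
next
  case (Suc l)
  have e0: "0 < e" using e by simp
  let ?K = "2 / ((1 - \<tau>) * real N)" and ?p = "(\<Prod>j=1..l. 1 + coord_sum e j) * coord_sum e (Suc l)"
  have K: "?K \<ge> 0" using tau by simp
  have p: "?p \<ge> 0" using e0 e by (intro mult_nonneg_nonneg prod_coord_sum_nonneg coord_sum_nonneg)
  have "z (Suc l) \<in> cbc_candidates \<alpha> \<gamma> \<tau> N (Suc l) z"
    using z Suc by (auto simp: cbc_vectors_def)
  from R_last_candidate_le[OF e N tau this]
  have "R_last (Suc l) N z \<le> (?K * ?p) powr (2 * e)" by simp
  then have "lattice_R (Suc l) \<alpha> \<gamma> N z \<le> (?K * weight_sum l \<alpha> \<gamma> e) powr (2 * e) + (?K * ?p) powr (2 * e)"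
    using Suc by (simp add: lattice_R_Suc)
  also have "\<dots> \<le> (?K * weight_sum l \<alpha> \<gamma> e + ?K * ?p) powr (2 * e)"
    using e0 e by (intro powr_superadditive mult_nonneg_nonneg[OF K] p weight_sum_nonneg) auto
  also have "?K * weight_sum l \<alpha> \<gamma> e + ?K * ?p = ?K * weight_sum (Suc l) \<alpha> \<gamma> e"
    by (simp add: weight_sum_eq_prod algebra_simps)
  finally show ?case .
qed

end

section \<open>Dual lattices of random generating vectors\<close>

lemma cbc_vectors_Suc:
  assumes l: "l \<ge> 1"
  shows "cbc_vectors (Suc l) \<alpha> \<gamma> \<tau> N =
    (\<lambda>(z, c). z(Suc l := c)) ` (SIGMA z:cbc_vectors l \<alpha> \<gamma> \<tau> N. cbc_candidates \<alpha> \<gamma> \<tau> N (Suc l) z)"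
    (is "?L = ?f ` ?R")
proof (intro equalityI subsetI)
  fix z assume z: "z \<in> ?L"
  let ?z = "z(Suc l := undefined)"
  have c: "cbc_candidates \<alpha> \<gamma> \<tau> N m ?z = cbc_candidates \<alpha> \<gamma> \<tau> N m z" if "m \<le> Suc l" for m
    by (rule cbc_candidates_cong) (use that in auto)
  have "?z \<in> cbc_vectors l \<alpha> \<gamma> \<tau> N"
    using z l by (auto simp: cbc_vectors_def c PiE_def Pi_def extensional_def simp del: One_nat_def)
  moreover have "z (Suc l) \<in> cbc_candidates \<alpha> \<gamma> \<tau> N (Suc l) ?z"
    using z l by (auto simp: cbc_vectors_def c)
  moreover have "?f (?z, z (Suc l)) = z" by simp
  ultimately show "z \<in> ?f ` ?R" by (metis (no_types, lifting) SigmaI image_eqI)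
next
  fix y assume "y \<in> ?f ` ?R"
  then obtain z c where z: "z \<in> cbc_vectors l \<alpha> \<gamma> \<tau> N" and c: "c \<in> cbc_candidates \<alpha> \<gamma> \<tau> N (Suc l) z"
    and y: "y = z(Suc l := c)" by auto
  have eq: "cbc_candidates \<alpha> \<gamma> \<tau> N m y = cbc_candidates \<alpha> \<gamma> \<tau> N m z" if "m \<le> Suc l" for m
    by (rule cbc_candidates_cong) (use that y in auto)
  have "c \<in> {1..N - 1}" using c cbc_candidates_subset by blast
  then have "y \<in> PiE {1..Suc l} (\<lambda>_. {1..N - 1})"
    using z y by (auto simp: cbc_vectors_def PiE_def Pi_def extensional_def)
  moreover have "y 1 = 1" using z y l by (simp add: cbc_vectors_def)
  moreover have "y m \<in> cbc_candidates \<alpha> \<gamma> \<tau> N m y" if "m \<in> {2..Suc l}" for m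
    using that z c by (cases "m = Suc l") (auto simp: eq y[symmetric] cbc_vectors_def, auto simp: y)
  ultimately show "y \<in> ?L" by (simp add: cbc_vectors_def)
qed

lemma finite_cbc_vectors: "finite (cbc_vectors s \<alpha> \<gamma> \<tau> N)"
  by (rule finite_subset[OF _ finite_PiE[of "{1..s}" "\<lambda>_. {1..N - 1}"]]) (auto simp: cbc_vectors_def)

lemma finite_cbc_candidates: "finite (cbc_candidates \<alpha> \<gamma> \<tau> N l z)"
  by (rule finite_subset[OF cbc_candidates_subset]) simp

text \<open>Counting fibrewise over the first \<open>l\<close> components. Extension by
  \<open>c\<close> is injective because a shorter vector is \<open>undefined\<close> at
  \<open>Suc l\<close>.\<close>

lemma card_cbc_vectors_Suc_filter:
  assumes l: "l \<ge> 1"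
  shows "card {z \<in> cbc_vectors (Suc l) \<alpha> \<gamma> \<tau> N. Q z} =
    (\<Sum>z\<in>cbc_vectors l \<alpha> \<gamma> \<tau> N. card {c \<in> cbc_candidates \<alpha> \<gamma> \<tau> N (Suc l) z. Q (z(Suc l := c))})"
proof -
  let ?S = "SIGMA z:cbc_vectors l \<alpha> \<gamma> \<tau> N. {c \<in> cbc_candidates \<alpha> \<gamma> \<tau> N (Suc l) z. Q (z(Suc l := c))}"
  have u: "z (Suc l) = undefined" if "z \<in> cbc_vectors l \<alpha> \<gamma> \<tau> N" for z
    using that by (auto simp: cbc_vectors_def PiE_def extensional_def)
  have "inj_on (\<lambda>(z, c). z(Suc l := c)) ?S"
  proof (rule inj_onI)
    fix x y assume x: "x \<in> ?S" and y: "y \<in> ?S"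
      and eq: "(\<lambda>(z, c). z(Suc l := c)) x = (\<lambda>(z, c). z(Suc l := c)) y"
    obtain z c z' c' where xy: "x = (z, c)" "y = (z', c')" by fastforce
    have eq: "z(Suc l := c) = z'(Suc l := c')" using eq xy by simp
    then have "c = c'" by (metis fun_upd_same)
    moreover have "z = z'"
    proof
      have "z (Suc l) = undefined" "z' (Suc l) = undefined" using u x y xy by auto
      fix j show "z j = z' j"
        using fun_cong[OF eq, of j] \<open>z (Suc l) = undefined\<close> \<open>z' (Suc l) = undefined\<close>
        by (cases "j = Suc l") auto
    qed
    ultimately show "x = y" using xy by simp
  qed
  then have "card ((\<lambda>(z, c). z(Suc l := c)) ` ?S) = card ?S" by (rule card_image)
  also have "(\<lambda>(z, c). z(Suc l := c)) ` ?S = {z \<in> cbc_vectors (Suc l) \<alpha> \<gamma> \<tau> N. Q z}"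
    unfolding cbc_vectors_Suc[OF l] by auto
  also have "card ?S = (\<Sum>z\<in>cbc_vectors l \<alpha> \<gamma> \<tau> N. card {c \<in> cbc_candidates \<alpha> \<gamma> \<tau> N (Suc l) z. Q (z(Suc l := c))})"
    by (rule card_SigmaI) (auto simp: finite_cbc_vectors finite_cbc_candidates)
  finally show ?thesis .
qed

lemma card_cbc_vectors_Suc:
  assumes "l \<ge> 1" "0 < \<tau>" "\<tau> < 1" "N \<ge> 2"
  shows "card (cbc_vectors (Suc l) \<alpha> \<gamma> \<tau> N) = cbc_size \<tau> N * card (cbc_vectors l \<alpha> \<gamma> \<tau> N)"
  using card_cbc_vectors_Suc_filter[of l \<alpha> \<gamma> \<tau> N "\<lambda>_. True"] assms
  by (simp add: card_cbc_candidates)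

text \<open>Only the last coordinate of \<open>k\<close> that is not divisible by \<open>N\<close> matters: for given preceding
  components at most one choice of the corresponding component solves the congruence. If this
  coordinate is the first one, \<open>z 1 = 1\<close> is not a solution.\<close>

lemma card_cbc_vectors_dual_le:
  assumes N: "prime N" and tau: "0 < \<tau>" "\<tau> < 1" and s: "s \<ge> 1" and k: "\<exists>j\<in>{1..s}. \<not> int N dvd k j"
  shows "cbc_size \<tau> N * card {z \<in> cbc_vectors s \<alpha> \<gamma> \<tau> N. int N dvd (\<Sum>j=1..s. k j * int (z j))}
           \<le> card (cbc_vectors s \<alpha> \<gamma> \<tau> N)"
  using s k
proof (induction s rule: nat_induct_at_least)
  case base
  then have "{z \<in> cbc_vectors 1 \<alpha> \<gamma> \<tau> N. int N dvd (\<Sum>j=1..1. k j * int (z j))} = {}"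
    by (auto simp: cbc_vectors_def)
  then show ?case by (metis card.empty mult_0_right zero_le)
next
  case (Suc l)
  let ?Z = "cbc_vectors l \<alpha> \<gamma> \<tau> N" and ?T = "cbc_size \<tau> N"
  let ?c = "\<lambda>z. cbc_candidates \<alpha> \<gamma> \<tau> N (Suc l) z"
  let ?S = "\<lambda>z. (\<Sum>j=1..l. k j * int (z j))"
  have N2: "N \<ge> 2" using N prime_ge_2_nat by blast
  have S: "(\<Sum>j=1..Suc l. k j * int ((z(Suc l := c)) j)) = ?S z + k (Suc l) * int c" for z c
    by (simp add: sum.cl_ivl_Suc)
  have eq: "card {z \<in> cbc_vectors (Suc l) \<alpha> \<gamma> \<tau> N. int N dvd (\<Sum>j=1..Suc l. k j * int (z j))}
     = (\<Sum>z\<in>?Z. card {c \<in> ?c z. int N dvd ?S z + k (Suc l) * int c})"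
    using card_cbc_vectors_Suc_filter[OF Suc.hyps, of \<alpha> \<gamma> \<tau> N "\<lambda>z. int N dvd (\<Sum>j=1..Suc l. k j * int (z j))"]
    by (simp only: S)
  show ?case
  proof (cases "int N dvd k (Suc l)")
    case False
    have "(\<Sum>z\<in>?Z. card {c \<in> ?c z. int N dvd ?S z + k (Suc l) * int c}) \<le> (\<Sum>z\<in>?Z. 1)"
      by (intro sum_mono card_congruence_solutions_le_1 N False cbc_candidates_subset)
    then show ?thesis
      unfolding eq card_cbc_vectors_Suc[OF Suc.hyps tau N2] by simp
  next
    case True
    have "\<exists>j\<in>{1..l}. \<not> int N dvd k j"
      using Suc.prems True by (metis atLeastAtMost_iff le_Suc_eq)
    then have IH: "?T * card {z \<in> ?Z. int N dvd ?S z} \<le> card ?Z" by (rule Suc.IH)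
    \<comment> \<open>The last component drops out of the congruence, so each prefix has either all
      its candidates as solutions or none.\<close>
    have "(\<Sum>z\<in>?Z. card {c \<in> ?c z. int N dvd ?S z + k (Suc l) * int c})
        = (\<Sum>z\<in>?Z. if int N dvd ?S z then ?T else 0)"
    proof (rule sum.cong[OF refl])
      fix z
      have "int N dvd ?S z + k (Suc l) * int c \<longleftrightarrow> int N dvd ?S z" for c
        using True by (simp add: dvd_add_left_iff)
      then show "card {c \<in> ?c z. int N dvd ?S z + k (Suc l) * int c} = (if int N dvd ?S z then ?T else 0)"
        by (simp add: card_cbc_candidates[OF tau N2])
    qed
    also have "\<dots> = card {z \<in> ?Z. int N dvd ?S z} * ?T"
      by (simp add: sum.If_cases finite_cbc_vectors Int_def)
    finally show ?thesis
      unfolding eq card_cbc_vectors_Suc[OF Suc.hyps tau N2] using IH by (simp add: mult.commute)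
  qed
qed

section \<open>Character sums and the error of a single rule\<close>

lemma sum_cis_lattice_point:
  fixes k :: "nat \<Rightarrow> int"
  assumes N: "N > 0"
  shows "(\<Sum>n<N. cis (phase s k (\<lambda>j\<in>{1..s}. frac (real n * real (z j) / real N))))
     = (if int N dvd (\<Sum>j=1..s. k j * int (z j)) then of_nat N else 0)"
proof -
  define K where "K = (\<Sum>j=1..s. k j * int (z j))"
  define \<omega> where "\<omega> = cis (2 * pi * (real_of_int K / real N))"
  have cis: "cis (phase s k (\<lambda>j\<in>{1..s}. frac (real n * real (z j) / real N))) = \<omega> ^ n" for n
  proof -
    \<comment> \<open>Removing integer parts from the points changes the phase only by a multiple of
      \<open>2 * pi\<close>.\<close>
    define m where "m = (\<Sum>j=1..s. k j * \<lfloor>real n * real (z j) / real N\<rfloor>)"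
    have "(\<Sum>j=1..s. real_of_int (k j) * (\<lambda>j\<in>{1..s}. frac (real n * real (z j) / real N)) j)
        = (\<Sum>j=1..s. real n * (real_of_int (k j * int (z j)) / real N) - real_of_int (k j * \<lfloor>real n * real (z j) / real N\<rfloor>))"
      by (intro sum.cong) (auto simp: frac_def algebra_simps)
    also have "\<dots> = real n * (real_of_int K / real N) - real_of_int m"
      by (simp add: sum_subtractf K_def m_def sum_distrib_left sum_divide_distrib)
    finally have "phase s k (\<lambda>j\<in>{1..s}. frac (real n * real (z j) / real N))
        = 2 * pi * (real n * (real_of_int K / real N) - real_of_int m)"
      unfolding phase_def by (simp only:)
    also have "\<dots> = real n * (2 * pi * (real_of_int K / real N)) - 2 * pi * real_of_int m"
      by (simp add: algebra_simps)
    finally have "cis (phase s k (\<lambda>j\<in>{1..s}. frac (real n * real (z j) / real N)))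
        = cis (real n * (2 * pi * (real_of_int K / real N))) / cis (2 * pi * real_of_int m)"
      by (simp only: cis_divide)
    also have "cis (2 * pi * real_of_int m) = 1"
      by (rule cis_multiple_2pi) simp
    also have "cis (real n * (2 * pi * (real_of_int K / real N))) = \<omega> ^ n"
      unfolding \<omega>_def by (rule Complex.DeMoivre[symmetric])
    finally show ?thesis by (simp only: div_by_1)
  qed
  have \<omega>1: "\<omega> = 1 \<longleftrightarrow> int N dvd K"
  proof
    assume "int N dvd K"
    then obtain q where "K = int N * q" by auto
    then show "\<omega> = 1" using N by (simp add: \<omega>_def cis_multiple_2pi)
  next
    assume "\<omega> = 1"
    then have "cos (2 * pi * (real_of_int K / real N)) = 1"
      by (simp add: \<omega>_def complex_eq_iff)
    then obtain q :: int where "2 * pi * (real_of_int K / real N) = real_of_int q * (2 * pi)"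
      by (auto simp: cos_one_2pi_int)
    then have "real_of_int K = real_of_int (q * int N)" using N by (simp add: field_simps)
    then have "K = q * int N" by (simp only: of_int_eq_iff)
    then show "int N dvd K" by simp
  qed
  have "\<omega> ^ N = cis (2 * pi * real_of_int K)"
    using N by (simp add: \<omega>_def Complex.DeMoivre)
  then have "\<omega> ^ N = 1" by (simp add: cis_multiple_2pi)
  then have "(\<Sum>n<N. \<omega> ^ n) = (if \<omega> = 1 then of_nat N else 0)"
    by (simp add: geometric_sum)
  then show ?thesis unfolding cis \<omega>1 K_def .
qed

lemma qmc_rule_lattice_points:
  "qmc_rule f (lattice_points s N z) =
     (\<Sum>n<N. f (\<lambda>j\<in>{1..s}. frac (real n * real (z j) / real N))) / real N"
  by (simp add: qmc_rule_def lattice_points_def image_mset.compositionality comp_def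
      sum_unfold_sum_mset atLeast0LessThan)

lemma fourier_coeff_0: "fourier_coeff s f (\<lambda>j\<in>{1..s}. 0) = complex_of_real (cube_integral s f)"
proof -
  have "phase s (\<lambda>j\<in>{1..s}. 0) x = 0" for x
    by (simp add: phase_def)
  then show ?thesis
    by (simp add: fourier_coeff_def cube_integral_def set_integral_complex_of_real)
qed

text \<open>Average the Fourier series over the points: the character sum keeps the dual frequencies
  alone. The zero frequency is always among them and contributes the integral, so the error is the
  sum over the others.\<close>

lemma qmc_error_le:
  assumes f: "f \<in> korobov_space s \<alpha> \<gamma>" and N: "N > 0"
  shows "\<bar>qmc_rule f (lattice_points s N z) - cube_integral s f\<bar>
     \<le> (\<Sum>\<^sub>\<infinity>k\<in>dual_lattice s N z - {\<lambda>j\<in>{1..s}. 0}. norm (fourier_coeff s f k))"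
proof -
  let ?c = "fourier_coeff s f" and ?D = "dual_lattice s N z" and ?o = "\<lambda>j\<in>{1..s}. 0 :: int"
  let ?x = "\<lambda>n. \<lambda>j\<in>{1..s}. frac (real n * real (z j) / real N)"
  have x: "?x n \<in> unit_cube s" for n
    by (auto simp: unit_cube_def frac_lt_1)
  have "((\<lambda>k. \<Sum>n<N. ?c k * cis (phase s k (?x n))) has_sum (\<Sum>n<N. complex_of_real (f (?x n)))) (int_vecs s)"
    by (intro has_sum_sum_finite) (use f x in \<open>auto simp: korobov_space_def\<close>)
  then have "((\<lambda>k. (\<Sum>n<N. ?c k * cis (phase s k (?x n))) * (1 / of_nat N)) has_sum
      (\<Sum>n<N. complex_of_real (f (?x n))) * (1 / of_nat N)) (int_vecs s)"
    by (rule has_sum_cmult_left)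
  also have "(\<Sum>n<N. complex_of_real (f (?x n))) * (1 / of_nat N) = complex_of_real (qmc_rule f (lattice_points s N z))"
    by (simp add: qmc_rule_lattice_points)
  finally have hs: "((\<lambda>k. (\<Sum>n<N. ?c k * cis (phase s k (?x n))) * (1 / of_nat N)) has_sum
      complex_of_real (qmc_rule f (lattice_points s N z))) (int_vecs s)" .
  have "(\<Sum>n<N. ?c k * cis (phase s k (?x n))) * (1 / of_nat N)
      = (if int N dvd (\<Sum>j=1..s. k j * int (z j)) then ?c k else 0)" for k
    unfolding sum_distrib_left[symmetric] sum_cis_lattice_point[OF N] using N by simp
  from hs[unfolded this] have "(?c has_sum complex_of_real (qmc_rule f (lattice_points s N z))) ?D"
    by (rule has_sum_cong_neutral[THEN iffD1, rotated -1]) (auto simp: mem_dual_lattice)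
  moreover have "?o \<in> ?D" by (simp add: mem_dual_lattice int_vecs_iff)
  ultimately have hs: "(?c has_sum complex_of_real (qmc_rule f (lattice_points s N z)) - ?c ?o) (?D - {?o})"
    by (intro has_sum_Diff) (auto simp: has_sum_finite_iff)
  have sm: "(\<lambda>k. norm (?c k)) summable_on (?D - {?o})"
    using f by (auto simp: korobov_space_def mem_dual_lattice elim!: summable_on_subset)
  have "norm (infsum ?c (?D - {?o})) \<le> (\<Sum>\<^sub>\<infinity>k\<in>?D - {?o}. norm (?c k))"
    by (rule norm_infsum_bound[OF sm])
  then show ?thesis
    unfolding infsumI[OF hs] fourier_coeff_0 by (simp flip: of_real_diff)
qed

section \<open>Frequencies with a common divisor\<close>

context weights
begin

text \<open>Each nonzero coordinate yields a factor \<open>1 / d powr \<alpha> \<le> 1\<close>, and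
  there is at least one such coordinate.\<close>

lemma w_div_le:
  assumes d: "d > 0" and k: "k \<in> int_vecs l" "k \<noteq> zero_vec l" "\<And>j. j \<in> {1..l} \<Longrightarrow> int d dvd k j"
  shows "w l k \<le> 1 / real d powr \<alpha> * w l (\<lambda>j\<in>{1..l}. k j div int d)"
proof -
  let ?k = "\<lambda>j\<in>{1..l}. k j div int d" and ?J = "{j\<in>{1..l}. k j \<noteq> 0}"
  have "w l k = (\<Prod>j=1..l. (if k j = 0 then 1 else 1 / real d powr \<alpha>)
      * (if ?k j = 0 then 1 else \<gamma> j / \<bar>real_of_int (?k j)\<bar> powr \<alpha>))"
    unfolding korobov_w_def
  proof (rule prod.cong[OF refl])
    fix j assume j: "j \<in> {1..l}"
    then obtain m where "k j = int d * m" using k by auto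
    then show "(if k j = 0 then 1 else \<gamma> j / \<bar>real_of_int (k j)\<bar> powr \<alpha>) =
      (if k j = 0 then 1 else 1 / real d powr \<alpha>) * (if ?k j = 0 then 1 else \<gamma> j / \<bar>real_of_int (?k j)\<bar> powr \<alpha>)"
      using j d by (simp add: abs_mult powr_mult)
  qed
  also have "\<dots> = (\<Prod>j=1..l. if k j = 0 then 1 else 1 / real d powr \<alpha>) * w l ?k"
    by (simp only: prod.distrib korobov_w_def)
  also have "(\<Prod>j=1..l. if k j = 0 then 1 else 1 / real d powr \<alpha>) = (1 / real d powr \<alpha>) ^ card ?J"
    by (simp add: prod.If_cases Int_def)
  also have "(1 / real d powr \<alpha>) ^ card ?J * w l ?k \<le> (1 / real d powr \<alpha>) ^ 1 * w l ?k"
  proof (intro mult_right_mono w_nonneg power_decreasing)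
    have "?J \<noteq> {}"
    proof
      assume "?J = {}"
      then have "k = zero_vec l" using k(1) by (auto simp: int_vecs_iff fun_eq_iff restrict_def)
      with k show False by simp
    qed
    then show "1 \<le> card ?J" by (simp add: Suc_le_eq card_gt_0_iff)
    show "1 / real d powr \<alpha> \<le> 1"
      using d alpha ge_one_powr_ge_zero[of "real d" \<alpha>] by (simp add: field_simps)
  qed auto
  finally show ?thesis by simp
qed

text \<open>Division by \<open>d\<close> maps \<open>F\<close> injectively to nonzero frequencies,
  so the full sum of squares remains after splitting off the gain of one coordinate.\<close>

lemma sum_w_sq_divisible_le:
  assumes d: "d > 0" and F: "finite F" "F \<subseteq> int_vecs l - {zero_vec l}"
    and dvd: "\<And>k j. k \<in> F \<Longrightarrow> j \<in> {1..l} \<Longrightarrow> int d dvd k j"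
  shows "(\<Sum>k\<in>F. (w l k)\<^sup>2) \<le> real d powr (- (2 * \<alpha>)) * weight_sum l \<alpha> \<gamma> (1/2)"
proof -
  define q where "q k = (\<lambda>j\<in>{1..l}. k j div int d)" for k :: "nat \<Rightarrow> int"
  have kq: "k j = int d * q k j" if "k \<in> F" "j \<in> {1..l}" for k j
    using dvd[OF that] that by (simp add: q_def)
  have und: "k j = undefined" if "k \<in> F" "j \<notin> {1..l}" for k j
    using F that by (auto simp: int_vecs_iff)
  have inj: "inj_on q F"
  proof (rule inj_onI)
    fix k k' assume k: "k \<in> F" "k' \<in> F" "q k = q k'"
    show "k = k'"
    proof
      fix j show "k j = k' j"
        using kq[OF k(1)] kq[OF k(2)] und[OF k(1)] und[OF k(2)] k(3) by (cases "j \<in> {1..l}") (simp_all del: atLeastAtMost_iff)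
    qed
  qed
  have sq: "(1 / real d powr \<alpha>)\<^sup>2 = real d powr (- (2 * \<alpha>))"
    by (simp add: powr_minus_divide power_one_over powr_add[symmetric] power2_eq_square)
  have "(\<Sum>k\<in>F. (w l k)\<^sup>2) \<le> (\<Sum>k\<in>F. (1 / real d powr \<alpha> * w l (q k))\<^sup>2)"
    unfolding q_def using F dvd by (intro sum_mono power_mono w_div_le d w_nonneg) auto
  also have "\<dots> = real d powr (- (2 * \<alpha>)) * (\<Sum>k\<in>F. (w l (q k))\<^sup>2)"
    by (simp only: power_mult_distrib sq sum_distrib_left)
  also have "(\<Sum>k\<in>F. (w l (q k))\<^sup>2) = (\<Sum>k\<in>q ` F. (w l k)\<^sup>2)"
    by (simp add: sum.reindex[OF inj])
  also have "\<dots> \<le> weight_sum l \<alpha> \<gamma> (1/2)"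
  proof (rule finite_sum_le_has_sum[OF has_sum_w_sq])
    show "q ` F \<subseteq> int_vecs l - {zero_vec l}"
    proof
      fix k' assume "k' \<in> q ` F"
      then obtain k where k: "k \<in> F" "k' = q k" by auto
      have "q k \<noteq> zero_vec l"
      proof
        assume z: "q k = zero_vec l"
        have "k = zero_vec l"
        proof
          fix j show "k j = zero_vec l j"
            using kq[OF k(1)] und[OF k(1)] z by (cases "j \<in> {1..l}") auto
        qed
        with F k show False by auto
      qed
      moreover have "q k \<in> int_vecs l" by (auto simp: int_vecs_iff q_def)
      ultimately show "k' \<in> int_vecs l - {zero_vec l}" using k by auto
    qed
  qed (use F in auto)
  finally show ?thesis by (simp add: mult_left_mono)
qed

end

section \<open>The randomized error\<close>

lemma primes_M_bounds:
  assumes "N \<in> primes_M M"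
  shows "prime N" "N \<le> M" "real M / 2 < real N"
proof -
  show "prime N" "N \<le> M" using assms by (auto simp: primes_M_def)
  have "real M / 2 \<le> real_of_int \<lceil>real M / 2\<rceil>" by (rule le_of_int_ceiling)
  also have "\<dots> < real_of_int (int N)" unfolding of_int_less_iff using assms by (simp add: primes_M_def)
  finally show "real M / 2 < real N" by simp
qed

lemma finite_primes_M: "finite (primes_M M)"
  by (rule finite_subset[of _ "{..M}"]) (auto simp: primes_M_def)

lemma card_primes_M_lower_bound:
  fixes \<epsilon> :: real
  assumes "\<epsilon> > 0"
  shows "\<exists>c>0. \<forall>M\<ge>2. primes_M M \<noteq> {} \<longrightarrow> c * real M powr (1 - \<epsilon>) \<le> real (card (primes_M M))"
proof -
  \<comment> \<open>The cap at \<open>1 / 2\<close> keeps \<open>1 - \<eta>\<close> positive, as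
    monotonicity of the power requires.\<close>
  define \<eta> where "\<eta> = min \<epsilon> (1 / 2)"
  have \<eta>: "\<eta> > 0" "\<eta> \<le> \<epsilon>" "\<eta> \<le> 1 / 2" using assms by (auto simp: \<eta>_def)
  obtain c where c: "c > 0" and le: "\<And>n. {p. prime p \<and> n < p \<and> p \<le> 2 * n} \<noteq> {} \<Longrightarrow>
      c * real n powr (1 - \<eta>) \<le> real (card {p. prime p \<and> n < p \<and> p \<le> 2 * n})"
    using card_primes_powr_lower_bound[OF \<eta>(1)] by auto
  show ?thesis
  proof (intro exI[of _ "c / 2"] conjI allI impI)
    show "c / 2 > 0" using c by simp
    fix M :: nat assume M: "M \<ge> 2" and ne: "primes_M M \<noteq> {}"
    define n where "n = nat \<lceil>real M / 2\<rceil>"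
    have n: "int n = \<lceil>real M / 2\<rceil>" unfolding n_def using M by simp
    have n1: "real M / 2 \<le> real n" using le_of_int_ceiling[of "real M / 2"] by (simp flip: n)
    have n2: "real n < real M / 2 + 1" using ceiling_correct[of "real M / 2"] by (simp flip: n)
    have "primes_M M = {p. prime p \<and> n < p \<and> p \<le> 2 * n}"
    proof (intro equalityI subsetI)
      fix p assume "p \<in> primes_M M"
      then show "p \<in> {p. prime p \<and> n < p \<and> p \<le> 2 * n}" using n1 by (auto simp: primes_M_def simp flip: n)
    next
      fix p assume "p \<in> {p. prime p \<and> n < p \<and> p \<le> 2 * n}"
      then have p: "prime p" "n < p" "p \<le> 2 * n" by auto
      have "p \<le> M"
      proof (rule ccontr)
        assume "\<not> p \<le> M"
        then have "M < p" by simp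
        moreover have "2 * n \<le> M + 1" using n2 by linarith
        \<comment> \<open>\<open>2 * n\<close> is \<open>M\<close> or \<open>M + 1\<close>; the
          possible surplus endpoint is even and hence not a prime above \<open>M\<close>.\<close>
        ultimately have "p = 2 * n" using p by linarith
        then have "p = 2" using p(1) primes_dvd_imp_eq[of 2 p] by simp
        with \<open>M < p\<close> M show False by simp
      qed
      with p show "p \<in> primes_M M" by (auto simp: primes_M_def simp flip: n)
    qed
    with le ne have "c * real n powr (1 - \<eta>) \<le> real (card (primes_M M))" by simp
    moreover have "real M powr (1 - \<epsilon>) \<le> 2 * real n powr (1 - \<eta>)"
    proof -
      have "real M powr (1 - \<epsilon>) \<le> real M powr (1 - \<eta>)"
        using M \<eta> by (intro powr_mono) auto
      also have "\<dots> \<le> (2 * real n) powr (1 - \<eta>)"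
        using n1 \<eta> by (intro powr_mono2) auto
      also have "\<dots> = 2 powr (1 - \<eta>) * real n powr (1 - \<eta>)"
        by (simp add: powr_mult)
      also have "\<dots> \<le> 2 powr 1 * real n powr (1 - \<eta>)"
        using \<eta> by (intro mult_right_mono powr_mono) auto
      finally show ?thesis by simp
    qed
    then have "c / 2 * real M powr (1 - \<epsilon>) \<le> c / 2 * (2 * real n powr (1 - \<eta>))"
      using c by (intro mult_left_mono) auto
    ultimately show "c / 2 * real M powr (1 - \<epsilon>) \<le> real (card (primes_M M))" by simp
  qed
qed

section \<open>Expectations over the random prime and the random vector\<close>

lemma mean_le:
  fixes g :: "'a \<Rightarrow> real"
  assumes "\<And>x. x \<in> A \<Longrightarrow> g x \<le> c" "0 \<le> c"
  shows "1 / real (card A) * sum g A \<le> c"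
proof -
  have "1 / real (card A) * sum g A \<le> 1 / real (card A) * (real (card A) * c)"
    using assms(1) by (intro mult_left_mono sum_bounded_above) auto
  \<comment> \<open>Over an empty set the mean is 0 by \<open>1 / 0 = 0\<close>; there
    \<open>0 \<le> c\<close> is used.\<close>
  also have "\<dots> \<le> c" using assms(2) by (cases "card A = 0") auto
  finally show ?thesis .
qed

definition cbc_mean ::
    "nat \<Rightarrow> real \<Rightarrow> (nat \<Rightarrow> real) \<Rightarrow> nat \<Rightarrow> real \<Rightarrow> (nat \<Rightarrow> (nat \<Rightarrow> nat) \<Rightarrow> real) \<Rightarrow> real" where
  "cbc_mean s \<alpha> \<gamma> M \<tau> g = 1 / real (card (primes_M M)) *
     (\<Sum>N\<in>primes_M M. 1 / real (card (cbc_vectors s \<alpha> \<gamma> \<tau> N)) * (\<Sum>z\<in>cbc_vectors s \<alpha> \<gamma> \<tau> N. g N z))"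

lemma cbc_mean_mono:
  assumes "\<And>N z. N \<in> primes_M M \<Longrightarrow> z \<in> cbc_vectors s \<alpha> \<gamma> \<tau> N \<Longrightarrow> g N z \<le> h N z"
  shows "cbc_mean s \<alpha> \<gamma> M \<tau> g \<le> cbc_mean s \<alpha> \<gamma> M \<tau> h"
  unfolding cbc_mean_def using assms by (intro mult_left_mono sum_mono) auto

lemma cbc_mean_nonneg:
  assumes "\<And>N z. g N z \<ge> 0"
  shows "cbc_mean s \<alpha> \<gamma> M \<tau> g \<ge> 0"
  unfolding cbc_mean_def using assms by (intro mult_nonneg_nonneg sum_nonneg) auto

lemma cbc_mean_le:
  assumes "\<And>N z. N \<in> primes_M M \<Longrightarrow> z \<in> cbc_vectors s \<alpha> \<gamma> \<tau> N \<Longrightarrow> g N z \<le> c" "0 \<le> c"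
  shows "cbc_mean s \<alpha> \<gamma> M \<tau> g \<le> c"
  unfolding cbc_mean_def using assms by (intro mean_le)

lemma cbc_mean_add:
  "cbc_mean s \<alpha> \<gamma> M \<tau> (\<lambda>N z. g N z + h N z) = cbc_mean s \<alpha> \<gamma> M \<tau> g + cbc_mean s \<alpha> \<gamma> M \<tau> h"
  unfolding cbc_mean_def by (simp add: sum.distrib distrib_left add_divide_distrib)

lemma cbc_mean_cmult:
  "cbc_mean s \<alpha> \<gamma> M \<tau> (\<lambda>N z. c * g N z) = c * cbc_mean s \<alpha> \<gamma> M \<tau> g"
  unfolding cbc_mean_def sum_distrib_left by (simp add: mult.left_commute)

lemma has_sum_cbc_mean:
  assumes "\<And>N z. N \<in> primes_M M \<Longrightarrow> z \<in> cbc_vectors s \<alpha> \<gamma> \<tau> N \<Longrightarrow> (h N z has_sum S N z) A"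
  shows "((\<lambda>k. cbc_mean s \<alpha> \<gamma> M \<tau> (\<lambda>N z. h N z k)) has_sum cbc_mean s \<alpha> \<gamma> M \<tau> S) A"
  unfolding cbc_mean_def
  by (intro has_sum_cmult_right has_sum_sum_finite finite_primes_M finite_cbc_vectors assms)

lemma sum_cbc_mean:
  "finite F \<Longrightarrow> (\<Sum>k\<in>F. cbc_mean s \<alpha> \<gamma> M \<tau> (\<lambda>N z. h N z k)) = cbc_mean s \<alpha> \<gamma> M \<tau> (\<lambda>N z. \<Sum>k\<in>F. h N z k)"
  by (induction F rule: finite_induct) (auto simp: cbc_mean_add, simp add: cbc_mean_def)

lemma rand_error_eq:
  "rand_error s \<alpha> \<gamma> M \<tau> = (SUP f\<in>{f \<in> korobov_space s \<alpha> \<gamma>. korobov_norm s \<alpha> \<gamma> f \<le> 1}.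
     ereal (cbc_mean s \<alpha> \<gamma> M \<tau> (\<lambda>N z. \<bar>qmc_rule f (lattice_points s N z) - cube_integral s f\<bar>)))"
  unfolding rand_error_def cbc_mean_def ..

section \<open>Probabilities of dual frequencies and the mean error\<close>

context weights
begin

text \<open>This and the next two definitions are the quantities \<open>p\<close>, \<open>p1\<close>
  and \<open>p2\<close> of the opening outline.\<close>

definition dual_prob :: "nat \<Rightarrow> nat \<Rightarrow> real \<Rightarrow> (nat \<Rightarrow> int) \<Rightarrow> real" where
  "dual_prob s M \<tau> k = cbc_mean s \<alpha> \<gamma> M \<tau> (\<lambda>N z. if k \<in> dual_lattice s N z then 1 else 0)"

definition proper_dual_prob :: "nat \<Rightarrow> nat \<Rightarrow> real \<Rightarrow> (nat \<Rightarrow> int) \<Rightarrow> real" where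
  "proper_dual_prob s M \<tau> k = cbc_mean s \<alpha> \<gamma> M \<tau>
     (\<lambda>N z. if k \<in> dual_lattice s N z \<and> (\<exists>j\<in>{1..s}. \<not> int N dvd k j) then 1 else 0)"

definition divisor_prob :: "nat \<Rightarrow> nat \<Rightarrow> (nat \<Rightarrow> int) \<Rightarrow> real" where
  "divisor_prob s M k = 1 / real (card (primes_M M)) *
     (\<Sum>N\<in>primes_M M. if \<forall>j\<in>{1..s}. int N dvd k j then 1 else 0)"

lemma dual_prob_nonneg: "dual_prob s M \<tau> k \<ge> 0"
  unfolding dual_prob_def by (rule cbc_mean_nonneg) auto

lemma proper_dual_prob_nonneg: "proper_dual_prob s M \<tau> k \<ge> 0"
  unfolding proper_dual_prob_def by (rule cbc_mean_nonneg) auto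

text \<open>A dual frequency either has a coordinate not divisible by \<open>N\<close> or is
  divisible by \<open>N\<close> throughout. The second event does not involve \<open>z\<close>, so
  averaging over \<open>z\<close> leaves at most its indicator.\<close>

lemma dual_prob_le: "dual_prob s M \<tau> k \<le> proper_dual_prob s M \<tau> k + divisor_prob s M k"
proof -
  let ?d = "\<lambda>N. if \<forall>j\<in>{1..s}. int N dvd k j then 1 else 0 :: real"
  have "dual_prob s M \<tau> k \<le> proper_dual_prob s M \<tau> k + cbc_mean s \<alpha> \<gamma> M \<tau> (\<lambda>N z. ?d N)"
    unfolding dual_prob_def proper_dual_prob_def cbc_mean_add[symmetric]
    by (rule cbc_mean_mono) auto
  also have "cbc_mean s \<alpha> \<gamma> M \<tau> (\<lambda>N z. ?d N) \<le> divisor_prob s M k"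
    unfolding cbc_mean_def divisor_prob_def
    by (intro mult_left_mono sum_mono mean_le) auto
  finally show ?thesis by simp
qed

lemma proper_dual_prob_le:
  assumes tau: "0 < \<tau>" "\<tau> < 1" and s: "s \<ge> 1" and M: "M \<ge> 2"
  shows "proper_dual_prob s M \<tau> k \<le> 4 / (\<tau> * real M)"
  unfolding proper_dual_prob_def cbc_mean_def
proof (rule mean_le)
  fix N assume N: "N \<in> primes_M M"
  let ?Z = "cbc_vectors s \<alpha> \<gamma> \<tau> N" and ?T = "cbc_size \<tau> N"
  let ?ex = "\<exists>j\<in>{1..s}. \<not> int N dvd k j"
  have N2: "N \<ge> 2" using primes_M_bounds(1)[OF N] prime_ge_2_nat by blast
  note T = cbc_size_bounds[OF tau N2]
  \<comment> \<open>\<open>N \<ge> 2\<close> and \<open>N > M / 2\<close> give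
    \<open>N - 1 \<ge> N / 2 > M / 4\<close>, which is the origin of the constant 4.\<close>
  have "real M / 4 \<le> real N - 1"
    using primes_M_bounds(3)[OF N] N2 by linarith
  then have "\<tau> * (real M / 4) \<le> \<tau> * (real N - 1)"
    using tau by (intro mult_left_mono) auto
  also have "\<dots> \<le> real ?T" by (rule T)
  finally have TM: "1 / real ?T \<le> 4 / (\<tau> * real M)"
    using tau M T(2) by (simp add: field_simps)
  define b where "b = card {z \<in> ?Z. k \<in> dual_lattice s N z \<and> ?ex}"
  have "?T * b \<le> card ?Z"
  proof (cases ?ex)
    case True
    have "b \<le> card {z \<in> ?Z. int N dvd (\<Sum>j=1..s. k j * int (z j))}"
      unfolding b_def by (rule card_mono) (auto simp: finite_cbc_vectors mem_dual_lattice)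
    then have "?T * b \<le> ?T * card {z \<in> ?Z. int N dvd (\<Sum>j=1..s. k j * int (z j))}"
      by (rule mult_le_mono2)
    also have "\<dots> \<le> card ?Z"
      by (rule card_cbc_vectors_dual_le[OF primes_M_bounds(1)[OF N] tau s True])
    finally show ?thesis .
  next
    case False
    then have "b = 0" unfolding b_def by (simp only: simp_thms) simp
    then show ?thesis by simp
  qed
  then have "real ?T * real b \<le> real (card ?Z)" by (metis of_nat_le_iff of_nat_mult)
  then have le: "real b \<le> real (card ?Z) * (1 / real ?T)" using T(2) by (simp add: field_simps)
  have "1 / real (card ?Z) * (\<Sum>z\<in>?Z. if k \<in> dual_lattice s N z \<and> ?ex then 1 else 0)
      = 1 / real (card ?Z) * real b"
    by (simp add: b_def sum.If_cases finite_cbc_vectors Int_def)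
  also have "\<dots> \<le> 1 / real (card ?Z) * (real (card ?Z) * (1 / real ?T))"
    using le by (intro mult_left_mono) auto
  also have "\<dots> \<le> 1 / real ?T" by (cases "card ?Z = 0") auto
  also note TM
  finally show "1 / real (card ?Z) * (\<Sum>z\<in>?Z. if k \<in> dual_lattice s N z \<and> ?ex then 1 else 0) \<le> 4 / (\<tau> * real M)" .
qed (use tau in auto)

text \<open>One factor of the squared probability is bounded uniformly; the other, enlarged to
  \<open>dual_prob\<close>, turns the sum into the expectation of a partial sum of
  \<open>lattice_R\<close>.\<close>

lemma sum_proper_dual_prob_sq_le:
  assumes tau: "0 < \<tau>" "\<tau> < 1" and s: "s \<ge> 1" and M: "M \<ge> 2"
    and F: "finite F" "F \<subseteq> int_vecs s - {zero_vec s}"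
    and \<rho>: "\<And>N z. N \<in> primes_M M \<Longrightarrow> z \<in> cbc_vectors s \<alpha> \<gamma> \<tau> N \<Longrightarrow> lattice_R s \<alpha> \<gamma> N z \<le> \<rho>" "\<rho> \<ge> 0"
  shows "(\<Sum>k\<in>F. (w s k * proper_dual_prob s M \<tau> k)\<^sup>2) \<le> 4 / (\<tau> * real M) * \<rho>"
proof -
  let ?p = "proper_dual_prob s M \<tau>"
  have "(\<Sum>k\<in>F. (w s k * ?p k)\<^sup>2) \<le> (\<Sum>k\<in>F. 4 / (\<tau> * real M) * ((w s k)\<^sup>2 * dual_prob s M \<tau> k))"
  proof (rule sum_mono)
    fix k
    have 1: "?p k \<le> dual_prob s M \<tau> k"
      unfolding proper_dual_prob_def dual_prob_def by (rule cbc_mean_mono) auto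
    have "?p k * ?p k \<le> 4 / (\<tau> * real M) * dual_prob s M \<tau> k"
      using tau by (intro mult_mono proper_dual_prob_le[OF tau s M] 1 proper_dual_prob_nonneg) auto
    then have "(w s k)\<^sup>2 * (?p k * ?p k) \<le> (w s k)\<^sup>2 * (4 / (\<tau> * real M) * dual_prob s M \<tau> k)"
      by (intro mult_left_mono) auto
    then show "(w s k * ?p k)\<^sup>2 \<le> 4 / (\<tau> * real M) * ((w s k)\<^sup>2 * dual_prob s M \<tau> k)"
      by (simp only: power2_eq_square mult_ac)
  qed
  also have "\<dots> = 4 / (\<tau> * real M) * (\<Sum>k\<in>F. (w s k)\<^sup>2 * dual_prob s M \<tau> k)"
    by (rule sum_distrib_left[symmetric])
  also have "(\<Sum>k\<in>F. (w s k)\<^sup>2 * dual_prob s M \<tau> k) =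
      cbc_mean s \<alpha> \<gamma> M \<tau> (\<lambda>N z. \<Sum>k\<in>F. (w s k)\<^sup>2 * (if k \<in> dual_lattice s N z then 1 else 0))"
    unfolding dual_prob_def cbc_mean_cmult[symmetric] by (rule sum_cbc_mean[OF F(1)])
  also have "\<dots> \<le> \<rho>"
  proof (rule cbc_mean_le[OF _ \<rho>(2)])
    fix N z assume Nz: "N \<in> primes_M M" "z \<in> cbc_vectors s \<alpha> \<gamma> \<tau> N"
    have "(\<Sum>k\<in>F. (w s k)\<^sup>2 * (if k \<in> dual_lattice s N z then 1 else 0)) = (\<Sum>k\<in>F \<inter> dual_lattice s N z. (w s k)\<^sup>2)"
      using F by (simp add: sum.inter_restrict if_distrib cong: if_cong)
    also have "\<dots> \<le> lattice_R s \<alpha> \<gamma> N z"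
      unfolding lattice_R_eq
      by (rule finite_sum_le_infsum) (use F in \<open>auto intro!: summable_w_sq simp: mem_dual_lattice\<close>)
    also have "\<dots> \<le> \<rho>" by (rule \<rho>(1)[OF Nz])
    finally show "(\<Sum>k\<in>F. (w s k)\<^sup>2 * (if k \<in> dual_lattice s N z then 1 else 0)) \<le> \<rho>" .
  qed
  finally show ?thesis using tau by (simp add: mult_left_mono divide_right_mono)
qed

text \<open>In the expansion of the square, two different primes \<open>N\<close>, \<open>N'\<close> dividing \<open>k\<close> force
  \<open>N * N'\<close> to divide \<open>k\<close>; this gains a factor \<open>N' powr (- (2 * \<alpha>)) \<le> 2 / M\<close> over the diagonal terms.\<close>

lemma sum_divisor_prob_sq_le:
  assumes M: "M \<ge> 2" and lam: "0 < lam" "lam < \<alpha>"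
    and F: "finite F" "F \<subseteq> int_vecs s - {zero_vec s}"
  shows "(\<Sum>k\<in>F. (w s k * divisor_prob s M k)\<^sup>2)
    \<le> (real M / 2) powr (- (2 * lam)) * weight_sum s \<alpha> \<gamma> (1/2) * (1 / real (card (primes_M M)) + 2 / real M)"
proof -
  let ?P = "primes_M M" and ?V = "weight_sum s \<alpha> \<gamma> (1/2)"
  let ?d = "\<lambda>N k. if \<forall>j\<in>{1..s}. int N dvd k j then 1 else 0 :: real"
  define A where "A = (real M / 2) powr (- (2 * lam)) * ?V"
  define q where "q = 1 / real (card ?P)"
  have V: "?V \<ge> 0" using alpha by (intro weight_sum_nonneg) auto
  have A0: "A \<ge> 0" unfolding A_def using V by simp
  have pair: "(\<Sum>k\<in>F. (w s k)\<^sup>2 * (?d N k * ?d N' k)) \<le> (if N = N' then A else 0) + A * (2 / real M)"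
    if N: "N \<in> ?P" and N': "N' \<in> ?P" for N N'
  proof -
    \<comment> \<open>The least common multiple of the two primes.\<close>
    define m where "m = (if N = N' then N else N * N')"
    have p: "prime N" "prime N'" using N N' primes_M_bounds by blast+
    have pos: "N \<ge> 1" "N' \<ge> 1" using p prime_ge_1_nat by blast+
    have m0: "m > 0" using pos by (simp add: m_def)
    have dvd: "int m dvd k j" if "int N dvd k j" "int N' dvd k j" for k :: "nat \<Rightarrow> int" and j
      using that p primes_coprime[OF p] by (auto simp: m_def intro!: divides_mult)
    define G where "G = {k\<in>F. \<forall>j\<in>{1..s}. int m dvd k j}"
    have "(\<Sum>k\<in>F. (w s k)\<^sup>2 * (?d N k * ?d N' k)) \<le> (\<Sum>k\<in>F. if k \<in> G then (w s k)\<^sup>2 else 0)"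
      by (rule sum_mono) (auto simp: G_def intro: dvd)
    also have "\<dots> = (\<Sum>k\<in>G. (w s k)\<^sup>2)"
      using F by (simp add: sum.If_cases G_def Int_def conj_ac cong: conj_cong)
    also have "\<dots> \<le> real m powr (- (2 * \<alpha>)) * ?V"
      by (rule sum_w_sq_divisible_le[OF m0]) (use F in \<open>auto simp: G_def\<close>)
    also have "\<dots> \<le> (if N = N' then A else 0) + A * (2 / real M)"
    proof -
      have N1: "real N powr (- (2 * \<alpha>)) \<le> (real M / 2) powr (- (2 * lam))"
      proof -
        have "real N powr (- (2 * \<alpha>)) \<le> real N powr (- (2 * lam))"
          using pos lam by (intro powr_mono) auto
        also have "\<dots> \<le> (real M / 2) powr (- (2 * lam))"
          using primes_M_bounds(3)[OF N] M lam by (intro powr_mono2') auto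
        finally show ?thesis .
      qed
      have N'1: "real N' powr (- (2 * \<alpha>)) \<le> 2 / real M"
      proof -
        have "real N' powr (- (2 * \<alpha>)) \<le> real N' powr (- 1)"
          using pos alpha by (intro powr_mono) auto
        also have "\<dots> \<le> 2 / real M"
          using primes_M_bounds(3)[OF N'] M pos by (simp add: powr_minus field_simps)
        finally show ?thesis .
      qed
      show ?thesis
      proof (cases "N = N'")
        case True
        have "real m powr (- (2 * \<alpha>)) * ?V \<le> A"
          unfolding A_def using N1 V True by (intro mult_right_mono) (auto simp: m_def)
        moreover have "A * (2 / real M) \<ge> 0" using A0 by simp
        ultimately show ?thesis using True by simp
      next
        case False
        then have "real m powr (- (2 * \<alpha>)) = real N powr (- (2 * \<alpha>)) * real N' powr (- (2 * \<alpha>))"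
          by (simp add: m_def powr_mult)
        also have "\<dots> \<le> (real M / 2) powr (- (2 * lam)) * (2 / real M)"
          by (intro mult_mono N1 N'1) auto
        finally have "real m powr (- (2 * \<alpha>)) * ?V \<le> (real M / 2) powr (- (2 * lam)) * (2 / real M) * ?V"
          using V by (intro mult_right_mono)
        also have "\<dots> = A * (2 / real M)" by (simp add: A_def)
        finally show ?thesis using False by simp
      qed
    qed
    finally show ?thesis .
  qed
  have "(\<Sum>k\<in>F. (w s k * divisor_prob s M k)\<^sup>2)
      = (\<Sum>k\<in>F. q\<^sup>2 * (\<Sum>N\<in>?P. \<Sum>N'\<in>?P. (w s k)\<^sup>2 * (?d N k * ?d N' k)))"
  proof (rule sum.cong[OF refl])
    fix k
    have "(divisor_prob s M k)\<^sup>2 = q\<^sup>2 * ((\<Sum>N\<in>?P. ?d N k) * (\<Sum>N\<in>?P. ?d N k))"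
      by (simp only: divisor_prob_def q_def power_mult_distrib power2_eq_square[of "\<Sum>N\<in>?P. ?d N k"])
    also have "(\<Sum>N\<in>?P. ?d N k) * (\<Sum>N\<in>?P. ?d N k) = (\<Sum>N\<in>?P. \<Sum>N'\<in>?P. ?d N k * ?d N' k)"
      by (rule sum_product)
    finally show "(w s k * divisor_prob s M k)\<^sup>2 = q\<^sup>2 * (\<Sum>N\<in>?P. \<Sum>N'\<in>?P. (w s k)\<^sup>2 * (?d N k * ?d N' k))"
      by (simp only: power_mult_distrib sum_distrib_left mult.left_commute)
  qed
  also have "\<dots> = q\<^sup>2 * (\<Sum>k\<in>F. \<Sum>N\<in>?P. \<Sum>N'\<in>?P. (w s k)\<^sup>2 * (?d N k * ?d N' k))"
    by (rule sum_distrib_left[symmetric])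
  also have "(\<Sum>k\<in>F. \<Sum>N\<in>?P. \<Sum>N'\<in>?P. (w s k)\<^sup>2 * (?d N k * ?d N' k))
      = (\<Sum>N\<in>?P. \<Sum>k\<in>F. \<Sum>N'\<in>?P. (w s k)\<^sup>2 * (?d N k * ?d N' k))"
    by (rule sum.swap)
  also have "\<dots> = (\<Sum>N\<in>?P. \<Sum>N'\<in>?P. \<Sum>k\<in>F. (w s k)\<^sup>2 * (?d N k * ?d N' k))"
    by (intro sum.cong refl sum.swap)
  \<comment> \<open>The term \<open>A * (2 / M)\<close> is granted to all pairs, diagonal ones
    included, so that the double sum has a closed form.\<close>
  also have "\<dots> \<le> (\<Sum>N\<in>?P. \<Sum>N'\<in>?P. (if N = N' then A else 0) + A * (2 / real M))"
    by (intro sum_mono pair)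
  also have "\<dots> = real (card ?P) * A + (real (card ?P))\<^sup>2 * (A * (2 / real M))"
    by (simp add: sum.distrib finite_primes_M power2_eq_square algebra_simps)
  also have "q\<^sup>2 * \<dots> \<le> A * (q + 2 / real M)"
  proof (cases "card ?P = 0")
    case True
    then show ?thesis using A0 by (simp add: q_def)
  next
    case False
    then have "q * real (card ?P) = 1" by (simp add: q_def)
    moreover have "q\<^sup>2 * (real (card ?P) * A + (real (card ?P))\<^sup>2 * (A * (2 / real M)))
        = q * (q * real (card ?P)) * A + (q * real (card ?P))\<^sup>2 * (A * (2 / real M))"
      by (simp only: power2_eq_square algebra_simps)
    ultimately show ?thesis by (simp add: algebra_simps)
  qed
  finally show ?thesis
    by (simp add: A_def q_def mult_left_mono)
qed

text \<open>Cauchy-Schwarz on finite partial sums, with the factors \<open>r * norm c\<close> and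
  \<open>w * p\<close>: the first has norm at most 1, the second is split by
  \<open>(x + y)\<^sup>2 \<le> 2 * x\<^sup>2 + 2 * y\<^sup>2\<close> into the two sums bounded
  above.\<close>

lemma cbc_mean_error_le:
  assumes tau: "0 < \<tau>" "\<tau> < 1" and s: "s \<ge> 1" and M: "M \<ge> 2" and lam: "0 < lam" "lam < \<alpha>"
    and \<rho>: "\<And>N z. N \<in> primes_M M \<Longrightarrow> z \<in> cbc_vectors s \<alpha> \<gamma> \<tau> N \<Longrightarrow> lattice_R s \<alpha> \<gamma> N z \<le> \<rho>" "\<rho> \<ge> 0"
    and f: "f \<in> korobov_space s \<alpha> \<gamma>" "korobov_norm s \<alpha> \<gamma> f \<le> 1"
  shows "cbc_mean s \<alpha> \<gamma> M \<tau> (\<lambda>N z. \<bar>qmc_rule f (lattice_points s N z) - cube_integral s f\<bar>)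
    \<le> sqrt (2 * (4 / (\<tau> * real M) * \<rho>) + 2 * ((real M / 2) powr (- (2 * lam)) *
        weight_sum s \<alpha> \<gamma> (1/2) * (1 / real (card (primes_M M)) + 2 / real M)))"
    (is "_ \<le> sqrt ?B")
proof -
  let ?c = "\<lambda>k. norm (fourier_coeff s f k)" and ?I = "int_vecs s - {zero_vec s}"
  let ?r = "korobov_r s \<alpha> \<gamma>" and ?p = "dual_prob s M \<tau>"
  let ?D = "\<lambda>N z. dual_lattice s N z - {zero_vec s}"
  have c_sm: "?c summable_on int_vecs s" using f by (simp add: korobov_space_def)
  have "cbc_mean s \<alpha> \<gamma> M \<tau> (\<lambda>N z. \<bar>qmc_rule f (lattice_points s N z) - cube_integral s f\<bar>)
      \<le> cbc_mean s \<alpha> \<gamma> M \<tau> (\<lambda>N z. \<Sum>\<^sub>\<infinity>k\<in>?D N z. ?c k)"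
    by (intro cbc_mean_mono qmc_error_le[OF f(1)]) (auto simp: prime_gt_0_nat dest: primes_M_bounds(1))
  also have "\<dots> \<le> sqrt ?B"
  proof (rule has_sum_le_finite_sums)
    have "((\<lambda>k. ?c k * (if k \<in> dual_lattice s N z then 1 else 0)) has_sum (\<Sum>\<^sub>\<infinity>k\<in>?D N z. ?c k)) ?I" for N z
    proof -
      have "(?c has_sum (\<Sum>\<^sub>\<infinity>k\<in>?D N z. ?c k)) (?D N z)"
        by (intro has_sum_infsum summable_on_subset[OF c_sm]) (auto simp: mem_dual_lattice)
      then show ?thesis
        by (rule has_sum_cong_neutral[THEN iffD1, rotated -1]) (auto simp: mem_dual_lattice)
    qed
    then have "((\<lambda>k. cbc_mean s \<alpha> \<gamma> M \<tau> (\<lambda>N z. ?c k * (if k \<in> dual_lattice s N z then 1 else 0)))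
        has_sum cbc_mean s \<alpha> \<gamma> M \<tau> (\<lambda>N z. \<Sum>\<^sub>\<infinity>k\<in>?D N z. ?c k)) ?I"
      by (intro has_sum_cbc_mean)
    then show "((\<lambda>k. ?c k * ?p k) has_sum cbc_mean s \<alpha> \<gamma> M \<tau> (\<lambda>N z. \<Sum>\<^sub>\<infinity>k\<in>?D N z. ?c k)) ?I"
      by (simp only: cbc_mean_cmult dual_prob_def)
  next
    fix F assume F: "finite F" "F \<subseteq> ?I"
    \<comment> \<open>If a weight vanishes under a nonzero entry, \<open>r\<close> and
      \<open>w\<close> are 0 by convention, but so is the Fourier coefficient; otherwise
      \<open>r * w = 1\<close>.\<close>
    have w: "?c k \<le> (?r k * ?c k) * w s k" if "k \<in> F" for k
    proof (cases "\<exists>j\<in>{1..s}. \<gamma> j = 0 \<and> k j \<noteq> 0")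
      case True
      then show ?thesis using f(1) that F by (auto simp: korobov_space_def)
    next
      case False
      then have "?r k \<noteq> 0" unfolding korobov_r_def by (subst prod_zero_iff) auto
      then have "?r k * w s k = 1" by (simp flip: inverse_korobov_r)
      then have "(?r k * w s k) * ?c k = ?c k" by simp
      then show ?thesis by (simp only: mult_ac order.refl)
    qed
    have "(\<Sum>k\<in>F. ?c k * ?p k) \<le> (\<Sum>k\<in>F. (?r k * ?c k) * (w s k * ?p k))"
      using mult_right_mono[OF w dual_prob_nonneg] by (intro sum_mono) (simp add: mult.assoc)
    also have "\<dots> \<le> sqrt ((\<Sum>k\<in>F. (?r k * ?c k)\<^sup>2) * (\<Sum>k\<in>F. (w s k * ?p k)\<^sup>2))"
      by (rule real_le_rsqrt[OF Cauchy_Schwarz_ineq_sum])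
    also have "\<dots> \<le> sqrt (1 * ?B)"
    proof (intro real_sqrt_le_mono mult_mono)
      have sm: "(\<lambda>k. (?r k)\<^sup>2 * (?c k)\<^sup>2) summable_on int_vecs s"
        using f(1) by (simp add: korobov_space_def)
      have "(\<Sum>k\<in>F. (?r k * ?c k)\<^sup>2) = (\<Sum>k\<in>F. (?r k)\<^sup>2 * (?c k)\<^sup>2)"
        by (simp add: power_mult_distrib)
      also have "\<dots> \<le> (\<Sum>\<^sub>\<infinity>k\<in>int_vecs s. (?r k)\<^sup>2 * (?c k)\<^sup>2)"
        by (rule finite_sum_le_infsum[OF sm]) (use F in auto)
      also have "\<dots> \<le> 1" using f(2) by (simp add: korobov_norm_def)
      finally show "(\<Sum>k\<in>F. (?r k * ?c k)\<^sup>2) \<le> 1" .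
    next
      have "(\<Sum>k\<in>F. (w s k * ?p k)\<^sup>2)
          \<le> (\<Sum>k\<in>F. 2 * (w s k * proper_dual_prob s M \<tau> k)\<^sup>2 + 2 * (w s k * divisor_prob s M k)\<^sup>2)"
      proof (rule sum_mono)
        fix k
        have "w s k * ?p k \<le> w s k * (proper_dual_prob s M \<tau> k + divisor_prob s M k)"
          by (intro mult_left_mono dual_prob_le w_nonneg)
        then have "(w s k * ?p k)\<^sup>2 \<le> (w s k * proper_dual_prob s M \<tau> k + w s k * divisor_prob s M k)\<^sup>2"
          by (intro power_mono mult_nonneg_nonneg w_nonneg dual_prob_nonneg) (simp add: distrib_left)
        also have "\<dots> \<le> 2 * (w s k * proper_dual_prob s M \<tau> k)\<^sup>2 + 2 * (w s k * divisor_prob s M k)\<^sup>2"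
          using sum_squares_bound[of "w s k * proper_dual_prob s M \<tau> k" "w s k * divisor_prob s M k"]
          by (simp add: power2_sum)
        finally show "(w s k * ?p k)\<^sup>2
          \<le> 2 * (w s k * proper_dual_prob s M \<tau> k)\<^sup>2 + 2 * (w s k * divisor_prob s M k)\<^sup>2" .
      qed
      also have "\<dots> = 2 * (\<Sum>k\<in>F. (w s k * proper_dual_prob s M \<tau> k)\<^sup>2) + 2 * (\<Sum>k\<in>F. (w s k * divisor_prob s M k)\<^sup>2)"
        by (simp add: sum.distrib sum_distrib_left)
      also have "\<dots> \<le> ?B"
        by (intro add_mono mult_left_mono sum_proper_dual_prob_sq_le[OF tau s M F \<rho>] sum_divisor_prob_sq_le[OF M lam F]) auto
      finally show "(\<Sum>k\<in>F. (w s k * ?p k)\<^sup>2) \<le> ?B" .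
    qed (auto intro: sum_nonneg)
    finally show "(\<Sum>k\<in>F. ?c k * ?p k) \<le> sqrt ?B" by simp
  qed
  finally show ?thesis .
qed

end

section \<open>Uniform figure of merit and convergence rate\<close>

lemma cbc_mean_empty: "primes_M M = {} \<Longrightarrow> cbc_mean s \<alpha> \<gamma> M \<tau> g = 0"
  by (simp add: cbc_mean_def)

context weights
begin

text \<open>Let \<open>y\<close> be the base of the power. For \<open>y \<le> 1\<close> the bound
  with exponent \<open>2 * lam\<close> may be weakened to \<open>2 * a\<close>. For
  \<open>y > 1\<close> it is enough to bound the figure of merit by 2: with \<open>e = 1/2\<close>
  the hypothesis on \<open>M\<close> gives the bound \<open>M / N \<le> 2\<close>.\<close>

lemma lattice_R_uniform_le:
  assumes tau: "0 < \<tau>" "\<tau> < 1" and s: "s \<ge> 1" and M: "M \<ge> 2" and lam: "1 / 2 \<le> lam" "lam < \<alpha>"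
    and a: "0 \<le> a" "a \<le> lam"
    and V: "2 / (1 - \<tau>) * weight_sum s \<alpha> \<gamma> (1/2) \<le> real M"
    and N: "N \<in> primes_M M" and z: "z \<in> cbc_vectors s \<alpha> \<gamma> \<tau> N"
  shows "lattice_R s \<alpha> \<gamma> N z \<le> 2 * (4 / ((1 - \<tau>) * real M) * weight_sum s \<alpha> \<gamma> lam) powr (2 * a)"
proof -
  let ?V = "weight_sum s \<alpha> \<gamma> (1/2)" and ?W = "weight_sum s \<alpha> \<gamma> lam"
  define y where "y = 4 / ((1 - \<tau>) * real M) * ?W"
  have W: "?W \<ge> 0" and V0: "?V \<ge> 0" using lam alpha by (auto intro!: weight_sum_nonneg)
  have y0: "y \<ge> 0" using W tau by (simp add: y_def)
  note p = primes_M_bounds[OF N]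
  have N0: "real N > 0" using p(1) by (simp add: prime_gt_0_nat)
  show ?thesis
  proof (cases "y \<le> 1")
    case True
    have le: "2 / ((1 - \<tau>) * real N) * ?W \<le> y"
      unfolding y_def
    proof (intro mult_right_mono W)
      have "2 / ((1 - \<tau>) * real N) = (1 / (1 - \<tau>)) * (2 / real N)" by simp
      also have "\<dots> \<le> (1 / (1 - \<tau>)) * (4 / real M)"
        using p(3) N0 M tau by (intro mult_left_mono) (auto simp: field_simps)
      finally show "2 / ((1 - \<tau>) * real N) \<le> 4 / ((1 - \<tau>) * real M)" by simp
    qed
    have "lattice_R s \<alpha> \<gamma> N z \<le> (2 / ((1 - \<tau>) * real N) * ?W) powr (2 * lam)"
      by (rule lattice_R_cbc_le[OF lam p(1) tau z s order.refl])
    also have "\<dots> \<le> y powr (2 * lam)"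
      using le W tau lam by (intro powr_mono2) auto
    also have "\<dots> \<le> y powr (2 * a)"
      using True y0 a by (intro powr_mono') auto
    also have "\<dots> \<le> 2 * y powr (2 * a)" by simp
    finally show ?thesis by (simp only: y_def)
  next
    case False
    have "lattice_R s \<alpha> \<gamma> N z \<le> (2 / ((1 - \<tau>) * real N) * ?V) powr (2 * (1 / 2))"
      by (rule lattice_R_cbc_le[OF _ _ p(1) tau z s order.refl]) (use alpha in auto)
    also have "\<dots> = (2 / (1 - \<tau>) * ?V) / real N"
      using V0 tau by simp
    also have "\<dots> \<le> real M / real N" using V N0 by (intro divide_right_mono) auto
    also have "\<dots> \<le> 2" using p(3) N0 by (simp add: field_simps)
    also have "\<dots> \<le> 2 * y powr (2 * a)" using False a by (simp add: ge_one_powr_ge_zero)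
    finally show ?thesis by (simp only: y_def)
  qed
qed

text \<open>Split \<open>V\<close> into \<open>V powr (\<delta> / lam)\<close>, bounded through
  \<open>x\<close>, and \<open>V powr (1 - \<delta> / lam)\<close>, bounded through the exponent
  \<open>lam\<close>. This lowers the power of the weight sum from \<open>2 * lam\<close> to
  \<open>2 * (lam - \<delta>)\<close> at the price of a small power of \<open>x\<close>, later
  \<open>M\<close>.\<close>

lemma weight_sum_half_interpolation:
  assumes lam: "1 / 2 \<le> lam" "lam < \<alpha>" and \<delta>: "0 \<le> \<delta>" "\<delta> \<le> lam" and V: "weight_sum s \<alpha> \<gamma> (1/2) \<le> x"
  shows "weight_sum s \<alpha> \<gamma> (1/2) \<le> x powr (\<delta> / lam) * weight_sum s \<alpha> \<gamma> lam powr (2 * (lam - \<delta>))"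
proof -
  let ?V = "weight_sum s \<alpha> \<gamma> (1/2)" and ?W = "weight_sum s \<alpha> \<gamma> lam"
  have V0: "?V \<ge> 0" using alpha by (intro weight_sum_nonneg) auto
  have "?V = ?V powr (\<delta> / lam) * ?V powr (1 - \<delta> / lam)"
    using V0 by (simp flip: powr_add)
  also have "\<dots> \<le> x powr (\<delta> / lam) * (?W powr (2 * lam)) powr (1 - \<delta> / lam)"
    using V V0 lam \<delta> by (intro mult_mono powr_mono2 weight_sum_half_le) auto
  also have "(?W powr (2 * lam)) powr (1 - \<delta> / lam) = ?W powr (2 * (lam - \<delta>))"
    using lam by (simp add: powr_powr algebra_simps)
  finally show ?thesis .
qed

lemma cbc_mean_error_rate:
  assumes tau: "0 < \<tau>" "\<tau> < 1" and s: "s \<ge> 1" and M: "M \<ge> 2"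
    and lam: "1 / 2 < lam" "lam < \<alpha>" and \<delta>: "0 < \<delta>" "\<delta> < lam"
    and V: "2 / (1 - \<tau>) * weight_sum s \<alpha> \<gamma> (1/2) \<le> real M"
    and c: "c > 0" "c * real M powr (1 - (2 * \<delta> - \<delta> / lam)) \<le> real (card (primes_M M))"
    and f: "f \<in> korobov_space s \<alpha> \<gamma>" "korobov_norm s \<alpha> \<gamma> f \<le> 1"
  shows "cbc_mean s \<alpha> \<gamma> M \<tau> (\<lambda>N z. \<bar>qmc_rule f (lattice_points s N z) - cube_integral s f\<bar>)
    \<le> sqrt (16 / \<tau> * (4 / (1 - \<tau>)) powr (2 * (lam - \<delta>)) + 2 * 2 powr (2 * lam) * (1 / c + 2))
        / real M powr (lam + 1/2 - \<delta>) * weight_sum s \<alpha> \<gamma> lam powr (lam - \<delta>)"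
proof -
  let ?V = "weight_sum s \<alpha> \<gamma> (1/2)" and ?W = "weight_sum s \<alpha> \<gamma> lam"
  define a where "a = lam - \<delta>"
  \<comment> \<open>Fixed by the exponents of \<open>M\<close> in the second term:
    \<open>- 2 * lam + \<delta> / lam + (\<epsilon> - 1) = - 2 * a - 1\<close>. It is positive
    because \<open>lam > 1 / 2\<close>.\<close>
  define \<epsilon> where "\<epsilon> = 2 * \<delta> - \<delta> / lam"
  \<comment> \<open>\<open>16 = 2 * 4 * 2\<close>: the splitting of the square, the bound on the
    proper probability, and the factor in \<open>\<rho>\<close>.\<close>
  define K1 where "K1 = 16 / \<tau> * (4 / (1 - \<tau>)) powr (2 * a)"
  define K2 where "K2 = 2 * 2 powr (2 * lam) * (1 / c + 2)"
  \<comment> \<open>Both terms under the root are brought to a constant times \<open>X\<close>,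
    whose square root is the claimed rate.\<close>
  define X where "X = ?W powr (2 * a) * real M powr (- (2 * a) - 1)"
  define \<rho> where "\<rho> = 2 * (4 / ((1 - \<tau>) * real M) * ?W) powr (2 * a)"
  have a: "a > 0" "a \<le> lam" using \<delta> by (auto simp: a_def)
  have W: "?W \<ge> 0" and V0: "?V \<ge> 0" using lam alpha by (auto intro!: weight_sum_nonneg)
  have M0: "real M > 0" using M by simp
  have \<epsilon>: "\<epsilon> > 0" using \<delta> lam by (simp add: \<epsilon>_def field_simps)
  have t1: "2 * (4 / (\<tau> * real M) * \<rho>) = K1 * X"
  proof -
    have "(4 / ((1 - \<tau>) * real M) * ?W) powr (2 * a) = ((4 / (1 - \<tau>)) * ?W * inverse (real M)) powr (2 * a)"
      by (simp add: field_simps)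
    also have "\<dots> = (4 / (1 - \<tau>)) powr (2 * a) * ?W powr (2 * a) * real M powr (- (2 * a))"
      by (simp only: powr_mult) (simp add: powr_minus inverse_powr)
    finally have "\<rho> = 2 * ((4 / (1 - \<tau>)) powr (2 * a) * ?W powr (2 * a) * real M powr (- (2 * a)))"
      by (simp add: \<rho>_def)
    moreover have "real M powr (- (2 * a) - 1) = real M powr (- (2 * a)) / real M"
      using M0 by (simp add: powr_diff)
    ultimately show ?thesis using M0 tau by (simp add: K1_def X_def)
  qed
  have t2: "2 * ((real M / 2) powr (- (2 * lam)) * ?V * (1 / real (card (primes_M M)) + 2 / real M)) \<le> K2 * X"
  proof -
    have "1 / (1 - \<tau>) \<ge> 1" using tau by simp
    then have "1 * ?V \<le> (2 / (1 - \<tau>)) * ?V" using V0 tau by (intro mult_right_mono) auto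
    then have "?V \<le> real M" using V by simp
    then have V1: "?V \<le> real M powr (\<delta> / lam) * ?W powr (2 * a)"
      unfolding a_def using lam \<delta> by (intro weight_sum_half_interpolation) auto
    have pos: "0 < c * real M powr (1 - \<epsilon>)" using c M0 by simp
    have "1 / real (card (primes_M M)) \<le> 1 / (c * real M powr (1 - \<epsilon>))"
      by (rule frac_le) (use c(2) pos in \<open>simp_all add: \<epsilon>_def\<close>)
    also have "\<dots> = 1 / c * real M powr (\<epsilon> - 1)"
      using powr_minus_divide[of "real M" "1 - \<epsilon>"] by simp
    finally have p1: "1 / real (card (primes_M M)) \<le> 1 / c * real M powr (\<epsilon> - 1)" .
    have "2 / real M = 2 * real M powr (- 1)" using M0 by (simp add: powr_minus_divide)
    also have "\<dots> \<le> 2 * real M powr (\<epsilon> - 1)" using M \<epsilon> by (intro mult_left_mono powr_mono) auto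
    finally have p2: "1 / real (card (primes_M M)) + 2 / real M \<le> (1 / c + 2) * real M powr (\<epsilon> - 1)"
      using p1 by (simp add: distrib_right)
    have p3: "(real M / 2) powr (- (2 * lam)) = 2 powr (2 * lam) * real M powr (- (2 * lam))"
      by (simp add: powr_divide powr_minus field_simps)
    have "(real M / 2) powr (- (2 * lam)) * ?V * (1 / real (card (primes_M M)) + 2 / real M)
        \<le> (2 powr (2 * lam) * real M powr (- (2 * lam))) * (real M powr (\<delta> / lam) * ?W powr (2 * a))
            * ((1 / c + 2) * real M powr (\<epsilon> - 1))"
      unfolding p3 using c V0 by (intro mult_mono V1 p2) auto
    also have "\<dots> = 2 powr (2 * lam) * (1 / c + 2) * ?W powr (2 * a)
        * (real M powr (- (2 * lam)) * real M powr (\<delta> / lam) * real M powr (\<epsilon> - 1))"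
      by (simp only: mult_ac)
    also have "real M powr (- (2 * lam)) * real M powr (\<delta> / lam) * real M powr (\<epsilon> - 1)
        = real M powr (- (2 * a) - 1)"
      unfolding powr_add[symmetric] a_def \<epsilon>_def
      by (rule arg_cong[where f = "\<lambda>x. real M powr x"]) (simp add: algebra_simps)
    finally show ?thesis by (simp add: K2_def X_def)
  qed
  have "cbc_mean s \<alpha> \<gamma> M \<tau> (\<lambda>N z. \<bar>qmc_rule f (lattice_points s N z) - cube_integral s f\<bar>)
    \<le> sqrt (2 * (4 / (\<tau> * real M) * \<rho>) + 2 * ((real M / 2) powr (- (2 * lam)) *
        ?V * (1 / real (card (primes_M M)) + 2 / real M)))"
  proof (rule cbc_mean_error_le[OF tau s M _ lam(2) _ _ f])
    show "lattice_R s \<alpha> \<gamma> N z \<le> \<rho>" if "N \<in> primes_M M" "z \<in> cbc_vectors s \<alpha> \<gamma> \<tau> N" for N z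
      unfolding \<rho>_def using lam a by (intro lattice_R_uniform_le[OF tau s M _ _ _ _ V that]) auto
  qed (use lam in \<open>auto simp: \<rho>_def\<close>)
  also have "\<dots> \<le> sqrt (K1 * X + K2 * X)"
    using t1 t2 by (intro real_sqrt_le_mono add_mono) auto
  also have "\<dots> = sqrt (K1 + K2) * sqrt X"
    by (simp add: real_sqrt_mult flip: distrib_right)
  also have "sqrt X = ?W powr a * real M powr (- (lam + 1/2 - \<delta>))"
  proof (rule real_sqrt_unique)
    have "(?W powr a)\<^sup>2 = ?W powr (2 * a)"
      by (simp add: power2_eq_square flip: powr_add)
    moreover have "(real M powr (- (lam + 1/2 - \<delta>)))\<^sup>2 = real M powr (- (2 * a) - 1)"
      by (simp add: power2_eq_square a_def algebra_simps flip: powr_add)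
    ultimately show "(?W powr a * real M powr (- (lam + 1/2 - \<delta>)))\<^sup>2 = X"
      by (simp only: power_mult_distrib X_def)
  qed auto
  also have "sqrt (K1 + K2) * (?W powr a * real M powr (- (lam + 1/2 - \<delta>)))
      = sqrt (K1 + K2) / real M powr (lam + 1/2 - \<delta>) * ?W powr a"
    by (simp only: powr_minus_divide) simp
  finally show ?thesis by (simp only: K1_def K2_def a_def)
qed

end

theorem theorem3p1:
  fixes lam \<delta> \<tau> :: real
  assumes "1/2 < lam" and "0 < \<delta>" and "\<delta> < min (lam - 1/2) 1" and "0 < \<tau>" and "\<tau> < 1"
  shows "\<exists>C>0. \<forall>(M::nat) (s::nat) (\<alpha>::real) (\<gamma>::nat \<Rightarrow> real).
           2 \<le> M \<longrightarrow> 1 \<le> s \<longrightarrow> 1/2 < \<alpha> \<longrightarrow> lam < \<alpha> \<longrightarrow>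
           (\<forall>j\<ge>1. 0 \<le> \<gamma> j \<and> \<gamma> j \<le> 1) \<longrightarrow>
           (INF l\<in>{1/2..<\<alpha>}. 2 / (1 - \<tau>) * weight_sum s \<alpha> \<gamma> l) \<le> real M \<longrightarrow>
           rand_error s \<alpha> \<gamma> M \<tau>
             \<le> ereal (C / real M powr (lam + 1/2 - \<delta>) * weight_sum s \<alpha> \<gamma> lam powr (lam - \<delta>))"
proof -
  have \<delta>: "\<delta> < lam" using assms by simp
  have "2 * \<delta> - \<delta> / lam > 0" using assms by (simp add: field_simps)
  from card_primes_M_lower_bound[OF this] obtain c where c: "c > 0"
    "\<And>M. M \<ge> 2 \<Longrightarrow> primes_M M \<noteq> {} \<Longrightarrow> c * real M powr (1 - (2 * \<delta> - \<delta> / lam)) \<le> real (card (primes_M M))"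
    by auto
  \<comment> \<open>\<open>c\<close> was obtained from \<open>2 * \<delta> - \<delta> / lam\<close>
    before \<open>M\<close>, \<open>s\<close>, \<open>\<alpha>\<close> and \<open>\<gamma>\<close>
    are fixed, so \<open>C\<close> depends on \<open>lam\<close>, \<open>\<delta>\<close> and
    \<open>\<tau>\<close> alone.\<close>
  define C where "C = sqrt (16 / \<tau> * (4 / (1 - \<tau>)) powr (2 * (lam - \<delta>)) + 2 * 2 powr (2 * lam) * (1 / c + 2))"
  show ?thesis
  proof (intro exI[of _ C] conjI allI impI)
    show "C > 0" unfolding C_def using assms c
      by (intro real_sqrt_gt_zero add_pos_pos mult_pos_pos) auto
    fix M s :: nat and \<alpha> :: real and \<gamma> :: "nat \<Rightarrow> real"
    assume M: "2 \<le> M" and s: "1 \<le> s" and \<alpha>: "1/2 < \<alpha>" "lam < \<alpha>"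
      and \<gamma>: "\<forall>j\<ge>1. 0 \<le> \<gamma> j \<and> \<gamma> j \<le> 1"
      and INF: "(INF l\<in>{1/2..<\<alpha>}. 2 / (1 - \<tau>) * weight_sum s \<alpha> \<gamma> l) \<le> real M"
    interpret weights \<alpha> \<gamma> by standard (use \<alpha> \<gamma> in auto)
    have "2 / (1 - \<tau>) * weight_sum s \<alpha> \<gamma> (1/2) \<le> (INF l\<in>{1/2..<\<alpha>}. 2 / (1 - \<tau>) * weight_sum s \<alpha> \<gamma> l)"
      using \<alpha> assms by (intro cINF_greatest mult_left_mono weight_sum_mono) auto
    with INF have V: "2 / (1 - \<tau>) * weight_sum s \<alpha> \<gamma> (1/2) \<le> real M" by linarith
    show "rand_error s \<alpha> \<gamma> M \<tau>
        \<le> ereal (C / real M powr (lam + 1/2 - \<delta>) * weight_sum s \<alpha> \<gamma> lam powr (lam - \<delta>))"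
      unfolding rand_error_eq
    proof (rule SUP_least, unfold ereal_less_eq)
      fix f assume "f \<in> {f \<in> korobov_space s \<alpha> \<gamma>. korobov_norm s \<alpha> \<gamma> f \<le> 1}"
      then have f: "f \<in> korobov_space s \<alpha> \<gamma>" "korobov_norm s \<alpha> \<gamma> f \<le> 1" by auto
      show "cbc_mean s \<alpha> \<gamma> M \<tau> (\<lambda>N z. \<bar>qmc_rule f (lattice_points s N z) - cube_integral s f\<bar>)
          \<le> C / real M powr (lam + 1/2 - \<delta>) * weight_sum s \<alpha> \<gamma> lam powr (lam - \<delta>)"
      \<comment> \<open>Without primes the mean is 0 and the bound is nonnegative; otherwise the
        lower bound for the number of primes applies.\<close>
      proof (cases "primes_M M = {}")
        case True
        have "C \<ge> 0" using \<open>C > 0\<close> by simp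
        then show ?thesis by (simp add: cbc_mean_empty[OF True])
      next
        case False
        show ?thesis
          unfolding C_def using assms \<alpha> \<delta>
          by (intro cbc_mean_error_rate[OF _ _ s M _ _ _ _ V c(1) c(2)[OF M False] f]) auto
      qed
    qed
  qed
qed

end
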